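(* The number of rank-3 matroids on ground set $[n]=\{1,\dots,n\}$ that have no minor isomorphic to $\mathcal{W}^3$ or to $M(K_4)$ is $2^{o(n^2)}$ as $n\to\infty$.
   Context: $\mathcal{W}^3$ is the rank-3 whirl: the rank-3 matroid on a 6-element set $\{a,b,c,d,e,f\}$ whose only dependent 3-sets are $\{a,b,c\},\{c,d,e\},\{e,f,a\}$. $M(K_4)$ is the cycle matroid of $K_4$; equivalently the rank-3 matroid on $\{a,b,c,d,e,f\}$ whose only dependent 3-sets are $\{a,b,c\},\{c,d,e\},\{e,f,a\},\{b,d,f\}$. Matroids are counted as labelled matroids on $[n]$. *)

theory Defs
  imports Complex_Main
begin

definition matroid :: "'a set \<Rightarrow> 'a set set \<Rightarrow> bool" where
  "matroid E I \<longleftrightarrow> finite E \<and> I \<subseteq> Pow E \<and> {} \<in> I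
     \<and> (\<forall>X Y. Y \<in> I \<and> X \<subseteq> Y \<longrightarrow> X \<in> I)
     \<and> (\<forall>X Y. X \<in> I \<and> Y \<in> I \<and> card X < card Y \<longrightarrow> (\<exists>y\<in>Y - X. insert y X \<in> I))"

definition mrank :: "'a set set \<Rightarrow> 'a set \<Rightarrow> nat" where
  "mrank I X = Max (card ` {Y. Y \<subseteq> X \<and> Y \<in> I})"

text \<open>Minor M / C \ D (C contracted, D deleted), via the rank of the contraction:
  X is independent in M/C\D iff r(X \<union> C) = |X| + r(C).\<close>
definition is_minor :: "('a set \<times> 'a set set) \<Rightarrow> ('a set \<times> 'a set set) \<Rightarrow> bool" where
  "is_minor N M \<longleftrightarrow> (\<exists>C D. C \<subseteq> fst M \<and> D \<subseteq> fst M \<and> C \<inter> D = {}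
      \<and> fst N = fst M - C - D
      \<and> snd N = {X. X \<subseteq> fst N \<and> mrank (snd M) (X \<union> C) = card X + mrank (snd M) C})"

definition matroid_iso :: "('a set \<times> 'a set set) \<Rightarrow> ('b set \<times> 'b set set) \<Rightarrow> bool" where
  "matroid_iso M N \<longleftrightarrow> (\<exists>f. bij_betw f (fst M) (fst N)
      \<and> (\<forall>X. X \<subseteq> fst M \<longrightarrow> (X \<in> snd M \<longleftrightarrow> f ` X \<in> snd N)))"

definition whirl3 :: "nat set \<times> nat set set" where
  "whirl3 = ({0..5}, {X. X \<subseteq> {0..5} \<and> card X \<le> 3
      \<and> X \<notin> {{0,1,2},{2,3,4},{4,5,0}}})"

definition MK4 :: "nat set \<times> nat set set" where
  "MK4 = ({0..5}, {X. X \<subseteq> {0..5} \<and> card X \<le> 3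
      \<and> X \<notin> {{0,1,2},{2,3,4},{4,5,0},{1,3,5}}})"

definition count_rk3 :: "nat \<Rightarrow> nat" where
  "count_rk3 n = card {I. matroid {1..n} I \<and> mrank I {1..n} = 3
      \<and> \<not> (\<exists>N. is_minor N ({1..n}, I) \<and> matroid_iso N whirl3)
      \<and> \<not> (\<exists>N. is_minor N ({1..n}, I) \<and> matroid_iso N MK4)}"

end

theory Submission
  imports Defs "HOL-Library.Disjoint_Sets"
begin

text \<open>
  Up to loops and parallel elements, a rank-3 matroid is a set of lines on its points. For three
  non-collinear points, pairwise joined by lines with at least three points, choose a third point
  on each joining line; the six points span \<open>M(K\<^sub>4)\<close> or \<open>\<W>\<^sup>3\<close>, according to whether the
  three chosen points are collinear. Hence excluding both means that three points pairwise joined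
  by long lines are collinear.

  Encode every long line \<open>x\<^sub>1 < \<dots> < x\<^sub>k\<close> by the triples \<open>(x\<^sub>1, x\<^sub>i, x\<^sub>i\<^sub>+\<^sub>1)\<close>. These triples are
  exactly the triangles of the tripartite graph formed by their three projections, and every edge
  lies in exactly one of them, so by Ruzsa and Szemeredi their number is \<open>o(n\<^sup>2)\<close>. The triples, and
  with them the collinear triples, are recovered from the three projections, which are subsets of
  \<open>[n]\<^sup>2\<close> of size \<open>o(n\<^sup>2)\<close>: there are \<open>2\<close> to the \<open>o(n\<^sup>2)\<close> of those. Counting the triples
  themselves as subsets of \<open>[n]\<^sup>3\<close> would lose a factor \<open>log n\<close> in the exponent. Loops and parallel
  classes contribute a factor of at most \<open>(n + 1)\<^sup>n\<close>.

  For the Ruzsa-Szemeredi bound, approximate the bipartite graph of pairs \<open>(b, c)\<close> in the least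
  squares sense by a combination of boundedly many rectangles that cannot be improved noticeably by
  adding exponentially many more. The pairs belonging to a fixed \<open>a\<close> form an induced matching, so the
  graph is nearly empty on the rectangle spanned by such a matching; if this happened inside many
  dense cells, subtracting a constant on these rectangles would improve the approximation.
\<close>

section \<open>Least-squares approximation by rectangles\<close>

definition step_fun :: "(real \<times> 'a set \<times> 'a set) list \<Rightarrow> 'a \<Rightarrow> 'a \<Rightarrow> real" where
  "step_fun xs x y = (\<Sum>(t, A, B)\<leftarrow>xs. if x \<in> A \<and> y \<in> B then t else 0)"

definition sq_err :: "'a set \<Rightarrow> ('a \<Rightarrow> 'a \<Rightarrow> real) \<Rightarrow> (real \<times> 'a set \<times> 'a set) list \<Rightarrow> real" where
  "sq_err V f xs = (\<Sum>(x, y)\<in>V \<times> V. (f x y - step_fun xs x y)\<^sup>2)"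

lemma step_fun_append: "step_fun (xs @ ys) x y = step_fun xs x y + step_fun ys x y"
  by (simp add: step_fun_def)

lemma step_fun_cong:
  assumes "\<And>p. p \<in> set xs \<Longrightarrow> x \<in> fst (snd p) \<longleftrightarrow> x' \<in> fst (snd p)"
    and "\<And>p. p \<in> set xs \<Longrightarrow> y \<in> snd (snd p) \<longleftrightarrow> y' \<in> snd (snd p)"
  shows "step_fun xs x y = step_fun xs x' y'"
  unfolding step_fun_def using assms
  by (intro arg_cong[where f = sum_list] map_cong) (auto split: prod.splits)

lemma step_fun_disjoint_rectangles:
  assumes "finite J" "disjoint_family_on (\<lambda>j. A j \<times> B j) J"
    and ys: "ys = map (\<lambda>j. (t, A j, B j)) js" "set js = J" "distinct js"
  shows "step_fun ys x y = (if (x, y) \<in> (\<Union>j\<in>J. A j \<times> B j) then t else 0)"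
proof -
  have "step_fun ys x y = (\<Sum>j\<in>J. if x \<in> A j \<and> y \<in> B j then t else 0)"
    using ys by (simp add: step_fun_def comp_def sum_list_distinct_conv_sum_set)
  also have "\<dots> = (if (x, y) \<in> (\<Union>j\<in>J. A j \<times> B j) then t else 0)"
  proof (cases "\<exists>j\<in>J. x \<in> A j \<and> y \<in> B j")
    case True
    then obtain j where j: "j \<in> J" "x \<in> A j" "y \<in> B j" by blast
    have "x \<in> A i \<and> y \<in> B i \<longleftrightarrow> i = j" if "i \<in> J" for i
      using assms(2) j that unfolding disjoint_family_on_def by blast
    then have "(\<Sum>j\<in>J. if x \<in> A j \<and> y \<in> B j then t else 0) = (\<Sum>i\<in>J. if i = j then t else 0)"
      by (intro sum.cong) simp_all
    then show ?thesis using j assms(1) by auto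
  next
    case False
    then show ?thesis by (auto intro!: sum.neutral)
  qed
  finally show ?thesis .
qed

text \<open>A list of k rectangles sorts rows and columns into at most 2^k classes each, so it cuts
  the square into at most 4^k cells. The bound on \<open>length ys\<close> leaves room for one new
  rectangle inside every cell.\<close>

definition unimprovable :: "real \<Rightarrow> 'a set \<Rightarrow> ('a \<Rightarrow> 'a \<Rightarrow> real) \<Rightarrow> (real \<times> 'a set \<times> 'a set) list \<Rightarrow> bool" where
  "unimprovable \<eta> V f xs \<longleftrightarrow> (\<forall>ys. length ys \<le> 4 ^ length xs \<longrightarrow>
     sq_err V f xs - \<eta> * (real (card V))\<^sup>2 \<le> sq_err V f (xs @ ys))"

fun tower_bound :: "nat \<Rightarrow> nat" where
  "tower_bound 0 = 0"
| "tower_bound (Suc i) = tower_bound i + 4 ^ tower_bound i"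

text \<open>Energy decrement: the empty list has error at most |V|^2, a list that fails to be
  unimprovable has an extension whose error is lower by more than \<eta> |V|^2, and errors are
  nonnegative. So at most \<open>m\<close> > 1/\<eta> rounds occur, and \<open>tower_bound m\<close>
  bounds the length independently of \<open>V\<close> and \<open>f\<close>.\<close>

lemma exists_unimprovable:
  assumes "\<eta> > 0"
  shows "\<exists>K. \<forall>(V :: 'a set) f. finite V \<and> (\<forall>x y. (f x y)\<^sup>2 \<le> 1) \<longrightarrow>
    (\<exists>xs. length xs \<le> K \<and> unimprovable \<eta> V f xs)"
proof -
  obtain m :: nat where m: "1 < real m * \<eta>"
    using assms reals_Archimedean3 by blast
  have "\<exists>xs. length xs \<le> tower_bound m \<and> unimprovable \<eta> V f xs"
    if V: "finite V" and f: "\<And>x y. (f x y)\<^sup>2 \<le> 1" for V :: "'a set" and f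
  proof -
    let ?N = "(real (card V))\<^sup>2"
    have *: "\<exists>xs. length xs \<le> tower_bound j \<and>
      (unimprovable \<eta> V f xs \<or> sq_err V f xs \<le> (1 - real j * \<eta>) * ?N)" for j
    proof (induction j)
      case 0
      have "sq_err V f [] \<le> (\<Sum>p\<in>V \<times> V. 1)"
        unfolding sq_err_def by (rule sum_mono) (auto simp: step_fun_def f)
      then show ?case
        by (intro exI[of _ "[]"]) (simp add: card_cartesian_product power2_eq_square)
    next
      case (Suc j)
      then obtain xs where xs: "length xs \<le> tower_bound j"
        "unimprovable \<eta> V f xs \<or> sq_err V f xs \<le> (1 - real j * \<eta>) * ?N" by blast
      show ?case
      proof (cases "unimprovable \<eta> V f xs")
        case True
        then show ?thesis using xs by (intro exI[of _ xs]) auto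
      next
        case False
        then obtain ys where ys: "length ys \<le> 4 ^ length xs"
          "sq_err V f (xs @ ys) < sq_err V f xs - \<eta> * ?N"
          unfolding unimprovable_def by (auto simp: not_le)
        have "(4::nat) ^ length xs \<le> 4 ^ tower_bound j"
          using xs by (intro power_increasing) auto
        with ys(1) xs(1) have "length (xs @ ys) \<le> tower_bound (Suc j)"
          unfolding tower_bound.simps length_append by linarith
        moreover have "sq_err V f (xs @ ys) \<le> (1 - real (Suc j) * \<eta>) * ?N"
          using ys(2) xs(2) False by (simp add: algebra_simps)
        ultimately show ?thesis by blast
      qed
    qed
    obtain xs where xs: "length xs \<le> tower_bound m"
      "unimprovable \<eta> V f xs \<or> sq_err V f xs \<le> (1 - real m * \<eta>) * ?N" using *[of m] by blast
    have nonneg: "0 \<le> sq_err V f zs" for zs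
      unfolding sq_err_def by (intro sum_nonneg) auto
    have "unimprovable \<eta> V f xs"
    proof (cases "card V = 0")
      case True
      then show ?thesis using V by (simp add: unimprovable_def sq_err_def)
    next
      case False
      then have "(1 - real m * \<eta>) * ?N < 0" using m by (intro mult_neg_pos) auto
      then show ?thesis using xs nonneg[of xs] by linarith
    qed
    then show ?thesis using xs by blast
  qed
  then show ?thesis by blast
qed

text \<open>Adding the constant \<open>t\<close> on a rectangle R lowers the squared error by 2t
  times the sum of the residual over R, minus t^2 |R|. By \<open>corr\<close> this gain is at least
  t^2 |R|. The gains of disjoint rectangles add up, and their total is limited by
  unimprovability.\<close>

lemma unimprovable_rectangles:
  fixes t :: real
  assumes xs: "unimprovable \<eta> V f xs" and V: "finite V"
    and J: "finite J" "card J \<le> 4 ^ length xs"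
    and sub: "\<And>j. j \<in> J \<Longrightarrow> A j \<subseteq> V" "\<And>j. j \<in> J \<Longrightarrow> B j \<subseteq> V"
    and disj: "disjoint_family_on (\<lambda>j. A j \<times> B j) J"
    and corr: "\<And>j. j \<in> J \<Longrightarrow> t\<^sup>2 * real (card (A j \<times> B j))
        \<le> t * (\<Sum>(x, y)\<in>A j \<times> B j. f x y - step_fun xs x y)"
  shows "t\<^sup>2 * (\<Sum>j\<in>J. real (card (A j \<times> B j))) \<le> \<eta> * (real (card V))\<^sup>2"
proof -
  obtain js where js: "set js = J" "distinct js" using J finite_distinct_list by blast
  define ys where "ys = map (\<lambda>j. (t, A j, B j)) js"
  define W where "W = (\<Union>j\<in>J. A j \<times> B j)"
  define u where "u = (\<lambda>(x, y). f x y - step_fun xs x y)"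
  have W: "W \<subseteq> V \<times> V" "finite W"
  proof -
    show "W \<subseteq> V \<times> V" unfolding W_def using sub by blast
    then show "finite W" using V finite_subset by blast
  qed
  have fin: "finite (A j \<times> B j)" if "j \<in> J" for j
    using sub[OF that] V finite_subset by blast
  have h: "step_fun ys x y = (if (x, y) \<in> W then t else 0)" for x y
    unfolding W_def using step_fun_disjoint_rectangles[OF J(1) disj ys_def js] .
  have "length ys \<le> 4 ^ length xs"
    using J js by (metis ys_def distinct_card length_map)
  then have "sq_err V f xs - \<eta> * (real (card V))\<^sup>2 \<le> sq_err V f (xs @ ys)"
    using xs unfolding unimprovable_def by blast
  also have "sq_err V f (xs @ ys) = (\<Sum>p\<in>V \<times> V. (u p)\<^sup>2 - (if p \<in> W then 2 * t * u p - t\<^sup>2 else 0))"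
    unfolding sq_err_def step_fun_append h u_def
    by (rule sum.cong) (auto simp: power2_eq_square algebra_simps)
  also have "\<dots> = sq_err V f xs - (\<Sum>p\<in>W. 2 * t * u p - t\<^sup>2)"
  proof -
    have "(\<Sum>p\<in>V \<times> V. if p \<in> W then 2 * t * u p - t\<^sup>2 else 0) = (\<Sum>p\<in>W. 2 * t * u p - t\<^sup>2)"
      using W V by (simp add: sum.If_cases Int_absorb1)
    then show ?thesis
      by (simp add: sum_subtractf sq_err_def u_def case_prod_unfold)
  qed
  also have "(\<Sum>p\<in>W. 2 * t * u p - t\<^sup>2) = (\<Sum>j\<in>J. \<Sum>p\<in>A j \<times> B j. 2 * t * u p - t\<^sup>2)"
    unfolding W_def using J fin disj
    by (intro sum.UNION_disjoint) (auto simp: disjoint_family_on_def)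
  also have "\<dots> = (\<Sum>j\<in>J. 2 * (t * (\<Sum>p\<in>A j \<times> B j. u p)) - t\<^sup>2 * real (card (A j \<times> B j)))"
    by (intro sum.cong refl) (simp add: sum_subtractf sum_distrib_left mult.assoc)
  finally have "(\<Sum>j\<in>J. 2 * (t * (\<Sum>p\<in>A j \<times> B j. u p)) - t\<^sup>2 * real (card (A j \<times> B j)))
      \<le> \<eta> * (real (card V))\<^sup>2" by simp
  moreover have "(\<Sum>j\<in>J. t\<^sup>2 * real (card (A j \<times> B j)))
      \<le> (\<Sum>j\<in>J. 2 * (t * (\<Sum>p\<in>A j \<times> B j. u p)) - t\<^sup>2 * real (card (A j \<times> B j)))"
    using corr by (intro sum_mono) (simp add: u_def)
  ultimately show ?thesis by (simp add: sum_distrib_left)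
qed

text \<open>Each class of \<open>\<alpha>\<close> that contains a sparse point meets
  \<open>W\<close> in fewer than \<epsilon> times its size in \<open>V\<close>, plus
  \<open>s\<close>, points. Summing over the classes gives the bound.\<close>

lemma card_sparse_le:
  fixes \<epsilon> s :: real
  assumes "finite V" "finite P" "W \<subseteq> V" "\<alpha> ` V \<subseteq> P" "0 \<le> \<epsilon>" "0 \<le> s"
  shows "real (card {x \<in> W. real (card {z \<in> W. \<alpha> z = \<alpha> x}) < \<epsilon> * real (card {z \<in> V. \<alpha> z = \<alpha> x}) + s})
    \<le> \<epsilon> * real (card V) + s * real (card P)" (is "real (card ?S) \<le> _")
proof -
  have "finite W" using assms finite_subset by blast
  have fS: "finite ?S" using \<open>finite W\<close> by simp
  have "\<alpha> ` ?S \<subseteq> P" using assms by blast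
  then have "real (card ?S) = (\<Sum>p\<in>P. real (card {x \<in> ?S. \<alpha> x = p}))"
    using sum.group[OF fS assms(2), of \<alpha> "\<lambda>_. 1::real"] by simp
  also have "\<dots> \<le> (\<Sum>p\<in>P. \<epsilon> * real (card {z \<in> V. \<alpha> z = p}) + s)"
  proof (rule sum_mono)
    fix p
    show "real (card {x \<in> ?S. \<alpha> x = p}) \<le> \<epsilon> * real (card {z \<in> V. \<alpha> z = p}) + s"
    proof (cases "{x \<in> ?S. \<alpha> x = p} = {}")
      case True
      have "0 \<le> \<epsilon> * real (card {z \<in> V. \<alpha> z = p}) + s" using assms by simp
      then show ?thesis unfolding True by simp
    next
      case False
      then obtain x where x: "x \<in> ?S" "\<alpha> x = p" by blast
      have "card {x \<in> ?S. \<alpha> x = p} \<le> card {z \<in> W. \<alpha> z = p}"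
        using \<open>finite W\<close> by (intro card_mono) auto
      then show ?thesis using x by simp
    qed
  qed
  also have "\<dots> = \<epsilon> * (\<Sum>p\<in>P. real (card {z \<in> V. \<alpha> z = p})) + s * real (card P)"
    by (simp add: sum.distrib sum_distrib_left)
  also have "(\<Sum>p\<in>P. real (card {z \<in> V. \<alpha> z = p})) = real (card V)"
    using sum.group[OF assms(1,2,4), of "\<lambda>_. 1::real"] by simp
  finally show ?thesis .
qed

section \<open>The Ruzsa-Szemeredi theorem\<close>

text \<open>The tripartite graph formed by the three projections of \<open>T\<close> is locally
  linear: each edge lies in exactly one triangle, and the triangles are the members of
  \<open>T\<close>.\<close>

definition unique_triangles :: "('a \<times> 'a \<times> 'a) set \<Rightarrow> bool" where
  "unique_triangles T \<longleftrightarrow>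
     (\<forall>a b c c'. (a, b, c) \<in> T \<and> (a, b, c') \<in> T \<longrightarrow> c = c') \<and>
     (\<forall>a b b' c. (a, b, c) \<in> T \<and> (a, b', c) \<in> T \<longrightarrow> b = b') \<and>
     (\<forall>a a' b c. (a, b, c) \<in> T \<and> (a', b, c) \<in> T \<longrightarrow> a = a') \<and>
     (\<forall>a a' b b' c c'. (a, b, c') \<in> T \<and> (a, b', c) \<in> T \<and> (a', b, c) \<in> T \<longrightarrow> (a, b, c) \<in> T)"

lemma card_fibred_le:
  assumes "finite V" "S \<subseteq> (SIGMA a:V. F a)" "\<And>a. a \<in> V \<Longrightarrow> finite (F a)"
    "\<And>a. a \<in> V \<Longrightarrow> real (card (F a)) \<le> B"
  shows "real (card S) \<le> real (card V) * B"
proof -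
  have "finite (SIGMA a:V. F a)" using assms by blast
  then have "real (card S) \<le> real (card (SIGMA a:V. F a))"
    using assms(2) by (intro of_nat_mono card_mono)
  also have "\<dots> = (\<Sum>a\<in>V. real (card (F a)))" using assms by (simp add: card_SigmaI)
  also have "\<dots> \<le> (\<Sum>a\<in>V. B)" using assms by (intro sum_mono) auto
  finally show ?thesis by simp
qed

text \<open>The triples are covered by five families: \<open>T1\<close> and \<open>T2\<close> with a
  sparse matching, and those in the cells \<open>J0\<close>, \<open>J1\<close>, \<open>J2\<close>.
  They contribute 2, 2, 2, 1 and 1 times \<epsilon> |V|^2. The hypothesis \<open>large\<close>
  absorbs the additive constant 2/\<epsilon> spent on each of the at most 2^(length xs)
  classes.\<close>

lemma card_unique_triangles_le:
  fixes T :: "('a \<times> 'a \<times> 'a) set" and \<epsilon> :: real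
  assumes V: "finite V" and T: "T \<subseteq> V \<times> V \<times> V" and ut: "unique_triangles T"
    and \<epsilon>: "0 < \<epsilon>" "\<epsilon> \<le> 1"
    and xs: "unimprovable (\<epsilon> ^ 5 / 4) V (\<lambda>x y. of_bool (\<exists>a. (a, x, y) \<in> T)) xs"
    and large: "2 / \<epsilon> * 2 ^ length xs \<le> \<epsilon> * real (card V)"
  shows "real (card T) \<le> 8 * \<epsilon> * (real (card V))\<^sup>2"
proof -
  define N where "N = real (card V)"
  define E where "E = {(b, c). \<exists>a. (a, b, c) \<in> T}"
  define f :: "'a \<Rightarrow> 'a \<Rightarrow> real" where "f x y = of_bool ((x, y) \<in> E)" for x y
  define g where "g = step_fun xs"
  define P where "P = Pow (set xs)"
  define \<alpha> where "\<alpha> x = {p \<in> set xs. x \<in> fst (snd p)}" for x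
  define \<beta> where "\<beta> y = {p \<in> set xs. y \<in> snd (snd p)}" for y
  define X where "X p = {z \<in> V. \<alpha> z = p}" for p
  define Y where "Y q = {z \<in> V. \<beta> z = q}" for q
  define U where "U a = {b. \<exists>c. (a, b, c) \<in> T}" for a
  define W where "W a = {c. \<exists>b. (a, b, c) \<in> T}" for a
  \<comment> \<open>The extra 2/\<epsilon> forces a dense class to be large in absolute terms, so
    that a matching between two dense classes has density at most \<epsilon>/2.\<close>
  define sU where "sU a = {x \<in> U a. real (card {z \<in> U a. \<alpha> z = \<alpha> x})
      < \<epsilon> * real (card {z \<in> V. \<alpha> z = \<alpha> x}) + 2 / \<epsilon>}" for a
  define sW where "sW a = {x \<in> W a. real (card {z \<in> W a. \<beta> z = \<beta> x})
      < \<epsilon> * real (card {z \<in> V. \<beta> z = \<beta> x}) + 2 / \<epsilon>}" for a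
  define area where "area j = real (card (X (fst j) \<times> Y (snd j)))" for j
  define e where "e j = real (card (E \<inter> (X (fst j) \<times> Y (snd j))))" for j
  define cell where "cell t = (case t of (a, b, c) \<Rightarrow> (\<alpha> b, \<beta> c))" for t :: "'a \<times> 'a \<times> 'a"

  have finT: "finite T" using T V by (meson finite_SigmaI finite_subset)
  have UV: "U a \<subseteq> V" "W a \<subseteq> V" for a unfolding U_def W_def using T by blast+
  have finU: "finite (U a)" "finite (W a)" for a
    using finite_subset[OF UV(1) V] finite_subset[OF UV(2) V] by auto
  have finX: "finite (X p)" "finite (Y p)" for p unfolding X_def Y_def using V by auto
  have P: "finite P" "\<alpha> ` V \<subseteq> P" "\<beta> ` V \<subseteq> P" unfolding P_def \<alpha>_def \<beta>_def by auto
  have cardP: "card P \<le> 2 ^ length xs"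
    unfolding P_def by (simp add: card_Pow card_length)
  have cardPP: "card J \<le> 4 ^ length xs" if "J \<subseteq> P \<times> P" for J
  proof -
    have "card J \<le> card (P \<times> P)" using that P by (intro card_mono) auto
    also have "\<dots> \<le> 2 ^ length xs * 2 ^ length xs"
      unfolding card_cartesian_product using cardP by (intro mult_mono) auto
    finally show ?thesis by (simp add: power_mult_distrib[symmetric])
  qed
  have \<epsilon>P: "2 / \<epsilon> * real (card P) \<le> \<epsilon> * N"
  proof -
    have "real (card P) \<le> 2 ^ length xs" using cardP by (metis of_nat_le_iff of_nat_numeral of_nat_power)
    then have "2 / \<epsilon> * real (card P) \<le> 2 / \<epsilon> * 2 ^ length xs" using \<epsilon> by (intro mult_left_mono) auto
    then show ?thesis using large unfolding N_def by linarith
  qed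
  have card_sU: "real (card (sU a)) \<le> 2 * \<epsilon> * N" for a
    using card_sparse_le[OF V P(1) UV(1)[of a] P(2), of \<epsilon> "2 / \<epsilon>"] \<epsilon> \<epsilon>P
    unfolding sU_def N_def by simp
  have card_sW: "real (card (sW a)) \<le> 2 * \<epsilon> * N" for a
    using card_sparse_le[OF V P(1) UV(2)[of a] P(3), of \<epsilon> "2 / \<epsilon>"] \<epsilon> \<epsilon>P
    unfolding sW_def N_def by simp

  have uniq: "(a, b, c) \<in> T \<Longrightarrow> (a, b, c') \<in> T \<Longrightarrow> c = c'"
    "(a, b, c) \<in> T \<Longrightarrow> (a, b', c) \<in> T \<Longrightarrow> b = b'"
    "(a, b, c) \<in> T \<Longrightarrow> (a', b, c) \<in> T \<Longrightarrow> a = a'" for a b c a' b' c'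
    using ut unfolding unique_triangles_def by blast+
  \<comment> \<open>The matching belonging to \<open>a\<close> is induced: every pair of
    \<open>E\<close> inside \<open>U a \<times> W a\<close> closes a triangle with \<open>a\<close>,
    hence belongs to that matching.\<close>
  have tri: "(a, b, c) \<in> T" if "b \<in> U a" "c \<in> W a" "(b, c) \<in> E" for a b c
    using ut that unfolding unique_triangles_def U_def W_def E_def by blast

  \<comment> \<open>Triples whose matching is sparse in the class of \<open>b\<close>, or in that of \<open>c\<close>, are few.\<close>
  define T1 where "T1 = {(a, b, c) \<in> T. b \<in> sU a}"
  define T2 where "T2 = {(a, b, c) \<in> T. c \<in> sW a}"
  have card_T1: "real (card T1) \<le> 2 * \<epsilon> * N\<^sup>2"
  proof -
    have "inj_on (\<lambda>(a, b, c). (a, b)) T1"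
      unfolding inj_on_def T1_def using uniq(1) by auto
    then have "card T1 = card ((\<lambda>(a, b, c). (a, b)) ` T1)" by (simp add: card_image)
    moreover have "real (card ((\<lambda>(a, b, c). (a, b)) ` T1)) \<le> real (card V) * (2 * \<epsilon> * N)"
    proof (rule card_fibred_le[OF V])
      show "(\<lambda>(a, b, c). (a, b)) ` T1 \<subseteq> (SIGMA a:V. sU a)"
        unfolding T1_def using T by auto
      show "finite (sU a)" for a unfolding sU_def using finU by simp
    qed (rule card_sU)
    ultimately show ?thesis by (simp add: N_def power2_eq_square mult_ac)
  qed
  have card_T2: "real (card T2) \<le> 2 * \<epsilon> * N\<^sup>2"
  proof -
    have "inj_on (\<lambda>(a, b, c). (a, c)) T2"
      unfolding inj_on_def T2_def using uniq(2) by auto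
    then have "card T2 = card ((\<lambda>(a, b, c). (a, c)) ` T2)" by (simp add: card_image)
    moreover have "real (card ((\<lambda>(a, b, c). (a, c)) ` T2)) \<le> real (card V) * (2 * \<epsilon> * N)"
    proof (rule card_fibred_le[OF V])
      show "(\<lambda>(a, b, c). (a, c)) ` T2 \<subseteq> (SIGMA a:V. sW a)"
        unfolding T2_def using T by auto
      show "finite (sW a)" for a unfolding sW_def using finU by simp
    qed (rule card_sW)
    ultimately show ?thesis by (simp add: N_def power2_eq_square mult_ac)
  qed

  have card_cells: "real (card {t \<in> T. cell t \<in> J}) \<le> (\<Sum>j\<in>J. e j)" if J: "finite J" for J
  proof -
    let ?S = "{t \<in> T. cell t \<in> J}"
    \<comment> \<open>An edge (b, c) lies in one triple only, so counting triples in cells reduces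
      to counting edges.\<close>
    have "inj_on snd ?S" unfolding inj_on_def using uniq(3) by auto
    then have "card ?S = card (snd ` ?S)" by (simp add: card_image)
    also have "\<dots> \<le> card (\<Union>j\<in>J. E \<inter> (X (fst j) \<times> Y (snd j)))"
    proof (rule card_mono)
      show "finite (\<Union>j\<in>J. E \<inter> (X (fst j) \<times> Y (snd j)))" using J finX by blast
      show "snd ` ?S \<subseteq> (\<Union>j\<in>J. E \<inter> (X (fst j) \<times> Y (snd j)))"
      proof
        fix p assume "p \<in> snd ` ?S"
        then obtain a b c where *: "p = (b, c)" "(a, b, c) \<in> T" "(\<alpha> b, \<beta> c) \<in> J"
          unfolding cell_def by auto
        then have "p \<in> E \<inter> (X (\<alpha> b) \<times> Y (\<beta> c))"
          using T unfolding E_def X_def Y_def by auto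
        then show "p \<in> (\<Union>j\<in>J. E \<inter> (X (fst j) \<times> Y (snd j)))" using *(3) by fastforce
      qed
    qed
    also have "\<dots> \<le> (\<Sum>j\<in>J. card (E \<inter> (X (fst j) \<times> Y (snd j))))" using J by (rule card_UN_le)
    finally show ?thesis unfolding e_def by (simp flip: of_nat_sum)
  qed
  have e_le_area: "e j \<le> area j" for j
    unfolding e_def area_def using finX by (intro of_nat_mono card_mono) auto
  have area_nonneg: "0 \<le> area j" for j unfolding area_def by simp
  have sum_X: "(\<Sum>p\<in>P. real (card (X p))) = N" "(\<Sum>p\<in>P. real (card (Y p))) = N"
    using sum.group[OF V P(1,2), of "\<lambda>_. 1::real"] sum.group[OF V P(1,3), of "\<lambda>_. 1::real"]
    unfolding X_def Y_def N_def by simp_all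
  have sum_area: "(\<Sum>j\<in>J. area j) \<le> N\<^sup>2" if "J \<subseteq> P \<times> P" for J
  proof -
    have "(\<Sum>j\<in>J. area j) \<le> (\<Sum>j\<in>P \<times> P. area j)"
      using that P area_nonneg by (intro sum_mono2) auto
    also have "\<dots> = (\<Sum>p\<in>P. real (card (X p))) * (\<Sum>q\<in>P. real (card (Y q)))"
      unfolding sum_product sum.cartesian_product area_def
      by (intro sum.cong) (auto simp: card_cartesian_product)
    finally show ?thesis unfolding sum_X power2_eq_square .
  qed
  have \<alpha>\<beta>: "p \<in> \<alpha> x \<longleftrightarrow> x \<in> fst (snd p)" "p \<in> \<beta> x \<longleftrightarrow> x \<in> snd (snd p)" if "p \<in> set xs" for p x
    using that unfolding \<alpha>_def \<beta>_def by auto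
  have g_cong: "g x y = g x' y'" if "\<alpha> x = \<alpha> x'" "\<beta> y = \<beta> y'" for x y x' y'
    unfolding g_def using that \<alpha>\<beta> by (intro step_fun_cong) metis+
  have f_eq: "(\<lambda>x y. of_bool (\<exists>a. (a, x, y) \<in> T)) = f"
    unfolding f_def E_def by auto
  have sum_f: "(\<Sum>(x, y)\<in>A \<times> B. f x y) = real (card (E \<inter> (A \<times> B)))" if "finite A" "finite B" for A B
    unfolding f_def using that by (simp add: case_prod_unfold of_bool_def sum.If_cases Int_commute)
  note rect = unimprovable_rectangles[OF xs[unfolded f_eq] V, folded g_def]
  have disj: "disjoint_family_on (\<lambda>j. A j \<times> B j) J"
    if AB: "\<And>j. j \<in> J \<Longrightarrow> A j \<subseteq> X (fst j)" "\<And>j. j \<in> J \<Longrightarrow> B j \<subseteq> Y (snd j)" for A B J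
  proof -
    have "A i \<times> B i \<inter> A j \<times> B j = {}" if ij: "i \<in> J" "j \<in> J" "i \<noteq> j" for i j
    proof (rule ccontr)
      assume "A i \<times> B i \<inter> A j \<times> B j \<noteq> {}"
      then obtain x y where "x \<in> A i" "x \<in> A j" "y \<in> B i" "y \<in> B j" by blast
      then have "x \<in> X (fst i)" "x \<in> X (fst j)" "y \<in> Y (snd i)" "y \<in> Y (snd j)"
        using AB ij by blast+
      then have "i = j" unfolding X_def Y_def by (simp add: prod_eq_iff)
      with ij show False by blast
    qed
    then show ?thesis unfolding disjoint_family_on_def by blast
  qed

  \<comment> \<open>\<open>J1\<close> and \<open>J2\<close> cover little area: otherwise adding \<open>\<epsilon>\<close> on the cells in \<open>J1\<close>, or
      \<open>- \<epsilon> / 2\<close> on the matching rectangles inside the cells in \<open>J2\<close>, would improve \<open>g\<close>.\<close>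
  define J0 where "J0 = {j \<in> P \<times> P. e j < 2 * \<epsilon> * area j}"
  define J1 where "J1 = {j \<in> P \<times> P. 2 * \<epsilon> * area j \<le> e j
      \<and> (\<exists>x\<in>X (fst j). \<exists>y\<in>Y (snd j). g x y < \<epsilon>)}"
  define J2 where "J2 = {j \<in> P \<times> P. (\<forall>x\<in>X (fst j). \<forall>y\<in>Y (snd j). \<epsilon> \<le> g x y)
      \<and> (\<exists>t\<in>T - T1 - T2. cell t = j)}"
  have JP: "J0 \<subseteq> P \<times> P" "J1 \<subseteq> P \<times> P" "J2 \<subseteq> P \<times> P" unfolding J0_def J1_def J2_def by auto
  have finJ: "finite J0" "finite J1" "finite J2" using JP P(1) by (meson finite_SigmaI finite_subset)+

  have card_J0: "real (card {t \<in> T. cell t \<in> J0}) \<le> 2 * \<epsilon> * N\<^sup>2"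
  proof -
    have "real (card {t \<in> T. cell t \<in> J0}) \<le> (\<Sum>j\<in>J0. e j)" by (rule card_cells[OF finJ(1)])
    also have "\<dots> \<le> (\<Sum>j\<in>J0. 2 * \<epsilon> * area j)" unfolding J0_def by (intro sum_mono) auto
    also have "\<dots> = 2 * \<epsilon> * (\<Sum>j\<in>J0. area j)" by (simp add: sum_distrib_left)
    also have "\<dots> \<le> 2 * \<epsilon> * N\<^sup>2" using sum_area[OF JP(1)] \<epsilon> by (intro mult_left_mono) auto
    finally show ?thesis .
  qed

  have card_J1: "real (card {t \<in> T. cell t \<in> J1}) \<le> \<epsilon> * N\<^sup>2"
  proof -
    have "\<epsilon>\<^sup>2 * (\<Sum>j\<in>J1. real (card (X (fst j) \<times> Y (snd j)))) \<le> (\<epsilon> ^ 5 / 4) * (real (card V))\<^sup>2"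
    proof (rule rect[OF finJ(2) cardPP[OF JP(2)]])
      show "disjoint_family_on (\<lambda>j. X (fst j) \<times> Y (snd j)) J1" by (rule disj) auto
      fix j assume j: "j \<in> J1"
      obtain x y where xy: "x \<in> X (fst j)" "y \<in> Y (snd j)" "g x y < \<epsilon>" using j unfolding J1_def by blast
      \<comment> \<open>\<open>g\<close> is constant on a cell, so one value below \<epsilon> bounds
        it on the whole cell. The edge density there is at least 2\<epsilon>, so the residual
        averages at least \<epsilon>, as \<open>rect\<close> requires with t = \<epsilon>.\<close>
      have "g x' y' \<le> \<epsilon>" if "x' \<in> X (fst j)" "y' \<in> Y (snd j)" for x' y'
        using g_cong[of x' x y' y] xy that unfolding X_def Y_def by simp
      then have "(\<Sum>(x, y)\<in>X (fst j) \<times> Y (snd j). g x y) \<le> (\<Sum>p\<in>X (fst j) \<times> Y (snd j). \<epsilon>)"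
        by (intro sum_mono) auto
      also have "\<dots> = \<epsilon> * area j" by (simp add: area_def)
      finally have "\<epsilon> * area j \<le> (\<Sum>(x, y)\<in>X (fst j) \<times> Y (snd j). f x y - g x y)"
        using sum_f[OF finX, of "fst j" "snd j"] j unfolding J1_def e_def
        by (simp add: case_prod_unfold sum_subtractf)
      then show "\<epsilon>\<^sup>2 * real (card (X (fst j) \<times> Y (snd j)))
          \<le> \<epsilon> * (\<Sum>(x, y)\<in>X (fst j) \<times> Y (snd j). f x y - g x y)"
        using \<epsilon> unfolding area_def power2_eq_square mult.assoc by (intro mult_left_mono) auto
    qed (auto simp: X_def Y_def)
    then have "\<epsilon>\<^sup>2 * (\<Sum>j\<in>J1. area j) \<le> \<epsilon>\<^sup>2 * (\<epsilon> ^ 3 / 4 * N\<^sup>2)"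
      unfolding area_def N_def by (simp add: power_def numeral_eq_Suc mult_ac)
    then have "(\<Sum>j\<in>J1. area j) \<le> \<epsilon> ^ 3 / 4 * N\<^sup>2"
      by (rule mult_left_le_imp_le) (use \<epsilon> in simp)
    also have "\<dots> \<le> \<epsilon> * N\<^sup>2"
    proof (rule mult_right_mono)
      have "\<epsilon> ^ 3 \<le> \<epsilon> ^ 1" using \<epsilon> by (intro power_decreasing) auto
      then show "\<epsilon> ^ 3 / 4 \<le> \<epsilon>" using \<epsilon> by simp
    qed simp
    finally show ?thesis
      using card_cells[OF finJ(2)] sum_mono[of J1 e area] e_le_area by fastforce
  qed

  have card_J2: "real (card {t \<in> T. cell t \<in> J2}) \<le> \<epsilon> * N\<^sup>2"
  proof -
    have "\<forall>j\<in>J2. \<exists>a b c. (a, b, c) \<in> T - T1 - T2 \<and> (\<alpha> b, \<beta> c) = j"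
      unfolding J2_def cell_def by fastforce
    \<comment> \<open>\<open>w j\<close> is the first vertex of a triple in cell \<open>j\<close>
      outside \<open>T1\<close> and \<open>T2\<close>. Its matching therefore occupies at least the
      fraction \<epsilon> of both sides of the cell, which makes \<open>A j \<times> B j\<close> a
      rectangle of noticeable area.\<close>
    then obtain w where w: "\<And>j. j \<in> J2 \<Longrightarrow> \<exists>b c. (w j, b, c) \<in> T - T1 - T2 \<and> (\<alpha> b, \<beta> c) = j"
      by metis
    define A where "A j = U (w j) \<inter> X (fst j)" for j
    define B where "B j = W (w j) \<inter> Y (snd j)" for j
    have finAB: "finite (A j)" "finite (B j)" for j unfolding A_def B_def using finX by auto
    have dense: "\<epsilon> * real (card (X (fst j))) \<le> real (card (A j))"
      "\<epsilon> * real (card (Y (snd j))) \<le> real (card (B j))" "2 / \<epsilon> \<le> real (card (B j))" if j: "j \<in> J2" for j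
    proof -
      obtain b c where bc: "(w j, b, c) \<in> T" "(w j, b, c) \<notin> T1" "(w j, b, c) \<notin> T2" "(\<alpha> b, \<beta> c) = j"
        using w[OF j] by blast
      then have "b \<in> U (w j)" "b \<notin> sU (w j)" "c \<in> W (w j)" "c \<notin> sW (w j)"
        unfolding U_def W_def T1_def T2_def by blast+
      moreover have "{z \<in> U (w j). \<alpha> z = \<alpha> b} = A j" "{z \<in> V. \<alpha> z = \<alpha> b} = X (fst j)"
        "{z \<in> W (w j). \<beta> z = \<beta> c} = B j" "{z \<in> V. \<beta> z = \<beta> c} = Y (snd j)"
        using bc(4) UV unfolding A_def B_def X_def Y_def by auto
      ultimately have *: "\<epsilon> * real (card (X (fst j))) + 2 / \<epsilon> \<le> real (card (A j))"
        "\<epsilon> * real (card (Y (snd j))) + 2 / \<epsilon> \<le> real (card (B j))"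
        unfolding sU_def sW_def by auto
      have "0 < 2 / \<epsilon>" "0 \<le> \<epsilon> * real (card (Y (snd j)))" using \<epsilon> by auto
      with * show "\<epsilon> * real (card (X (fst j))) \<le> real (card (A j))"
        "\<epsilon> * real (card (Y (snd j))) \<le> real (card (B j))" "2 / \<epsilon> \<le> real (card (B j))" by linarith+
    qed
    have "(- \<epsilon> / 2)\<^sup>2 * (\<Sum>j\<in>J2. real (card (A j \<times> B j))) \<le> (\<epsilon> ^ 5 / 4) * (real (card V))\<^sup>2"
    proof (rule rect[OF finJ(3) cardPP[OF JP(3)]])
      show "disjoint_family_on (\<lambda>j. A j \<times> B j) J2" by (rule disj) (auto simp: A_def B_def)
      fix j assume j: "j \<in> J2"
      let ?m = "real (card (A j \<times> B j))"
      \<comment> \<open>The pairs of \<open>E\<close> in \<open>A j \<times> B j\<close> form a matching, as all of them close a triangle with \<open>w j\<close>.\<close>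
      have "inj_on fst (E \<inter> (A j \<times> B j))"
      proof (rule inj_onI)
        fix p q assume "p \<in> E \<inter> (A j \<times> B j)" "q \<in> E \<inter> (A j \<times> B j)" "fst p = fst q"
        then have "(w j, fst p, snd p) \<in> T" "(w j, fst p, snd q) \<in> T"
          using tri[of "fst p" "w j"] unfolding A_def B_def by auto
        with uniq(1) \<open>fst p = fst q\<close> show "p = q" by (simp add: prod_eq_iff)
      qed
      then have "card (E \<inter> (A j \<times> B j)) \<le> card (A j)"
        using finAB by (intro card_inj_on_le[of fst]) auto
      moreover have "real (card (A j)) \<le> \<epsilon> / 2 * ?m"
      proof -
        have "1 \<le> \<epsilon> / 2 * real (card (B j))" using dense(3)[OF j] \<epsilon> by (simp add: field_simps)
        then have "real (card (A j)) * 1 \<le> real (card (A j)) * (\<epsilon> / 2 * real (card (B j)))"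
          by (intro mult_left_mono) auto
        then show ?thesis by (simp add: card_cartesian_product mult_ac)
      qed
      \<comment> \<open>On \<open>A j \<times> B j\<close> the edge density is at most \<epsilon>/2
        while \<open>g\<close> is at least \<epsilon>, so the residual averages at most
        -\<epsilon>/2. This allows t = -\<epsilon>/2 in \<open>rect\<close>.\<close>
      ultimately have "(\<Sum>(x, y)\<in>A j \<times> B j. f x y) \<le> \<epsilon> / 2 * ?m"
        unfolding sum_f[OF finAB] by linarith
      moreover have "\<epsilon> * ?m \<le> (\<Sum>(x, y)\<in>A j \<times> B j. g x y)"
      proof -
        have "(\<Sum>p\<in>A j \<times> B j. \<epsilon>) \<le> (\<Sum>(x, y)\<in>A j \<times> B j. g x y)"
          using j unfolding J2_def A_def B_def by (intro sum_mono) auto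
        then show ?thesis by (simp add: mult_ac)
      qed
      ultimately have "(\<Sum>(x, y)\<in>A j \<times> B j. f x y - g x y) \<le> - (\<epsilon> / 2) * ?m"
        by (simp add: case_prod_unfold sum_subtractf)
      then have "\<epsilon> / 2 * (\<Sum>(x, y)\<in>A j \<times> B j. f x y - g x y) \<le> \<epsilon> / 2 * (- (\<epsilon> / 2) * ?m)"
        using \<epsilon> by (intro mult_left_mono) auto
      then show "(- \<epsilon> / 2)\<^sup>2 * ?m \<le> - \<epsilon> / 2 * (\<Sum>(x, y)\<in>A j \<times> B j. f x y - g x y)"
        by (simp add: power2_eq_square)
    qed (use UV in \<open>auto simp: A_def B_def\<close>)
    moreover have "\<epsilon>\<^sup>2 * (\<Sum>j\<in>J2. area j) \<le> (\<Sum>j\<in>J2. real (card (A j \<times> B j)))"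
      unfolding sum_distrib_left
    proof (rule sum_mono)
      fix j assume "j \<in> J2"
      then have "(\<epsilon> * real (card (X (fst j)))) * (\<epsilon> * real (card (Y (snd j))))
          \<le> real (card (A j)) * real (card (B j))"
        using dense(1,2) \<epsilon> by (intro mult_mono) auto
      then show "\<epsilon>\<^sup>2 * area j \<le> real (card (A j \<times> B j))"
        by (simp add: area_def card_cartesian_product power2_eq_square mult_ac)
    qed
    ultimately have "(- \<epsilon> / 2)\<^sup>2 * (\<epsilon>\<^sup>2 * (\<Sum>j\<in>J2. area j)) \<le> (\<epsilon> ^ 5 / 4) * (real (card V))\<^sup>2"
      using mult_left_mono[of "\<epsilon>\<^sup>2 * (\<Sum>j\<in>J2. area j)" _ "(- \<epsilon> / 2)\<^sup>2"] by fastforce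
    \<comment> \<open>A gain of \<epsilon>^2/4 per unit of area, on rectangles filling at least
      \<epsilon>^2 of each cell, gives \<epsilon>^4/4. This is why the tolerance is
      \<epsilon>^5/4.\<close>
    then have "\<epsilon> ^ 4 / 4 * (\<Sum>j\<in>J2. area j) \<le> \<epsilon> ^ 4 / 4 * (\<epsilon> * N\<^sup>2)"
      unfolding N_def by (simp add: power_def numeral_eq_Suc mult_ac)
    then have "(\<Sum>j\<in>J2. area j) \<le> \<epsilon> * N\<^sup>2"
      by (rule mult_left_le_imp_le) (use \<epsilon> in simp)
    then show ?thesis
      using card_cells[OF finJ(3)] sum_mono[of J2 e area] e_le_area by fastforce
  qed

  have "T \<subseteq> T1 \<union> T2 \<union> {t \<in> T. cell t \<in> J0} \<union> {t \<in> T. cell t \<in> J1} \<union> {t \<in> T. cell t \<in> J2}"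
  proof
    fix t assume t: "t \<in> T"
    have "cell t \<in> P \<times> P"
      unfolding cell_def P_def \<alpha>_def \<beta>_def by (auto split: prod.splits)
    \<comment> \<open>A cell in neither \<open>J0\<close> nor \<open>J1\<close> has \<open>g\<close>
      at least \<epsilon> throughout. If \<open>t\<close> avoids \<open>T1\<close> and
      \<open>T2\<close>, it is itself the witness that places its cell in \<open>J2\<close>.\<close>
    then have "t \<in> T1 \<union> T2 \<or> cell t \<in> J0 \<union> J1 \<union> J2"
      unfolding J0_def J1_def J2_def using t by (auto simp: not_le not_less) blast
    with t show "t \<in> T1 \<union> T2 \<union> {t \<in> T. cell t \<in> J0} \<union> {t \<in> T. cell t \<in> J1} \<union> {t \<in> T. cell t \<in> J2}"
      by blast
  qed
  moreover have "T1 \<subseteq> T" "T2 \<subseteq> T" unfolding T1_def T2_def by auto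
  ultimately have "card T \<le> card (T1 \<union> T2 \<union> {t \<in> T. cell t \<in> J0} \<union> {t \<in> T. cell t \<in> J1} \<union> {t \<in> T. cell t \<in> J2})"
    using finT by (intro card_mono) (auto intro: finite_subset[OF _ finT])
  also have "\<dots> \<le> card T1 + card T2 + card {t \<in> T. cell t \<in> J0} + card {t \<in> T. cell t \<in> J1}
      + card {t \<in> T. cell t \<in> J2}"
    by (intro card_Un_le[THEN order.trans] add_right_mono order.refl)
  finally have "real (card T) \<le> real (card T1) + real (card T2) + real (card {t \<in> T. cell t \<in> J0})
      + real (card {t \<in> T. cell t \<in> J1}) + real (card {t \<in> T. cell t \<in> J2})" by linarith
  then show ?thesis
    using card_T1 card_T2 card_J0 card_J1 card_J2 unfolding N_def by linarith
qed

text \<open>The length bound \<open>K\<close> depends on \<epsilon> alone, so a single threshold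
  \<open>n0\<close> makes the previous bound applicable to all larger vertex sets.\<close>

lemma ruzsa_szemeredi:
  fixes \<delta> :: real
  assumes "0 < \<delta>"
  obtains n0 where "\<And>V T. finite (V :: 'a set) \<Longrightarrow> n0 \<le> card V \<Longrightarrow> T \<subseteq> V \<times> V \<times> V
    \<Longrightarrow> unique_triangles T \<Longrightarrow> real (card T) \<le> \<delta> * (real (card V))\<^sup>2"
proof -
  define \<epsilon> where "\<epsilon> = min (\<delta> / 8) 1"
  have \<epsilon>: "0 < \<epsilon>" "\<epsilon> \<le> 1" "8 * \<epsilon> \<le> \<delta>" using assms unfolding \<epsilon>_def by auto
  have "0 < \<epsilon> ^ 5 / 4" using \<epsilon> by simp
  from exists_unimprovable[OF this] obtain K where
    K: "\<forall>(V :: 'a set) f. finite V \<and> (\<forall>x y. (f x y)\<^sup>2 \<le> 1) \<longrightarrow>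
      (\<exists>xs. length xs \<le> K \<and> unimprovable (\<epsilon> ^ 5 / 4) V f xs)" by blast
  obtain n0 :: nat where n0: "2 / \<epsilon> * 2 ^ K / \<epsilon> \<le> real n0" using real_arch_simple by blast
  show ?thesis
  proof (rule that)
    fix V :: "'a set" and T
    assume *: "finite V" "n0 \<le> card V" "T \<subseteq> V \<times> V \<times> V" "unique_triangles T"
    have "\<forall>x y. (of_bool (\<exists>a. (a, x, y) \<in> T) :: real)\<^sup>2 \<le> 1" by (simp add: power_le_one)
    from K[THEN spec, THEN spec, THEN mp, OF conjI[OF *(1) this]]
    obtain xs where xs: "length xs \<le> K"
      "unimprovable (\<epsilon> ^ 5 / 4) V (\<lambda>x y. of_bool (\<exists>a. (a, x, y) \<in> T)) xs"
      by blast
    have "2 / \<epsilon> * 2 ^ length xs \<le> 2 / \<epsilon> * 2 ^ K"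
      using xs(1) \<epsilon> by (intro mult_left_mono power_increasing) auto
    also have "\<dots> \<le> \<epsilon> * real n0" using n0 \<epsilon> by (simp add: field_simps)
    also have "\<dots> \<le> \<epsilon> * real (card V)" using *(2) \<epsilon> by simp
    finally have "real (card T) \<le> 8 * \<epsilon> * (real (card V))\<^sup>2"
      using card_unique_triangles_le[OF *(1,3,4) \<epsilon>(1,2) xs(2)] by blast
    also have "\<dots> \<le> \<delta> * (real (card V))\<^sup>2" using \<epsilon>(3) by (intro mult_right_mono) auto
    finally show "real (card T) \<le> \<delta> * (real (card V))\<^sup>2" .
  qed
qed

section \<open>Lines encoded by triples\<close>

text \<open>Three distinct points on a common line, for lines determined by any two of their points:
  \<open>exchange\<close> says that two points lying on the line ab are on one line with b.\<close>

locale collinearity =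
  fixes C :: "nat \<Rightarrow> nat \<Rightarrow> nat \<Rightarrow> bool"
  assumes swap12: "C a b c \<Longrightarrow> C b a c"
    and swap23: "C a b c \<Longrightarrow> C a c b"
    and irrefl: "\<not> C a a c"
    and exchange: "C a b c \<Longrightarrow> C a b d \<Longrightarrow> c \<noteq> d \<Longrightarrow> C b c d"
begin

lemma perms: "C a b c \<Longrightarrow> C a c b \<and> C b a c \<and> C b c a \<and> C c a b \<and> C c b a"
  using swap12 swap23 by blast

lemma shared_pair:
  assumes "C a b c" "C a b d" "c \<noteq> d"
  shows "C a c d \<and> C b c d"
  using exchange[OF assms] exchange[of b a c d] perms assms by blast

lemma distinct: "C a b c \<Longrightarrow> a \<noteq> b \<and> a \<noteq> c \<and> b \<noteq> c"
  using irrefl perms by metis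

end

definition line_triples :: "(nat \<Rightarrow> nat \<Rightarrow> nat \<Rightarrow> bool) \<Rightarrow> (nat \<times> nat \<times> nat) set" where
  "line_triples C = {(a, b, c). a < b \<and> b < c \<and> C a b c \<and> (\<forall>d<a. \<not> C d b c)
     \<and> (\<forall>d. b < d \<and> d < c \<longrightarrow> \<not> C b d c)}"

text \<open>Any two entries of a triple determine its line, and then the third entry as the
  successor of b, the predecessor of c, or the first point. For a triangle of the projections,
  \<open>tri\<close> makes a, b, c collinear. That a comes first on the line is inherited from (a,
  b, c'), and that b and c are consecutive from (a', b, c).\<close>

lemma (in collinearity) unique_triangles_line_triples:
  assumes tri: "\<And>a b c x y z. C a b x \<Longrightarrow> C b c y \<Longrightarrow> C a c z \<Longrightarrow> C a b c"
  shows "unique_triangles (line_triples C)"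
  unfolding unique_triangles_def
proof (intro conjI allI impI; elim conjE)
  fix a b c c' assume T: "(a, b, c) \<in> line_triples C" "(a, b, c') \<in> line_triples C"
  have "\<not> u < v" if "(a, b, u) \<in> line_triples C" "(a, b, v) \<in> line_triples C" for u v
    using that shared_pair[of a b u v] unfolding line_triples_def by auto
  with T show "c = c'" by (meson linorder_neqE)
next
  fix a b b' c assume T: "(a, b, c) \<in> line_triples C" "(a, b', c) \<in> line_triples C"
  have "\<not> u < v" if "(a, u, c) \<in> line_triples C" "(a, v, c) \<in> line_triples C" for u v
    using that shared_pair[of a c u v] perms[of a u c] perms[of a v c] perms[of c u v]
    unfolding line_triples_def by auto
  with T show "b = b'" by (meson linorder_neqE)
next
  fix a a' b c assume "(a, b, c) \<in> line_triples C" "(a', b, c) \<in> line_triples C"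
  then show "a = a'" unfolding line_triples_def by (auto intro: linorder_cases[of a a'])
next
  fix a a' b b' c c'
  assume T: "(a, b, c') \<in> line_triples C" "(a, b', c) \<in> line_triples C" "(a', b, c) \<in> line_triples C"
  then have lt: "a < b" "b < c" "b < c'" and C: "C a b c'" "C a c b'" "C b c a'"
    using perms unfolding line_triples_def by blast+
  have abc: "C a b c" using tri[OF C(1,3,2)] .
  have "\<not> C d b c" if "d < a" for d
  proof
    assume "C d b c"
    then have "C a b d" using shared_pair[of b c a d] abc perms that by blast
    moreover have "d \<noteq> c'" using that lt by linarith
    ultimately have "C d b c'" using shared_pair[of a b d c'] C(1) perms by blast
    then show False using T(1) that unfolding line_triples_def by blast
  qed
  with abc lt T(3) show "(a, b, c) \<in> line_triples C" unfolding line_triples_def by blast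
qed

text \<open>Consecutive points of a line, together with its first point, form an encoded triple.
  Longer gaps are bridged by induction, gluing along shared pairs, and an arbitrary triple of the
  line is assembled through its first point.\<close>

lemma line_triples_determine:
  assumes "collinearity C" "collinearity D" "line_triples C = line_triples D" "C a b c"
  shows "D a b c"
proof -
  interpret C: collinearity C by fact
  interpret D: collinearity D by fact
  have first: "D a x y" if "a < x" "x < y" "C a x y" "\<forall>d<a. \<not> C d x y" for a x y
    using that
  proof (induction "y - x" arbitrary: x y rule: less_induct)
    case less
    show ?case
    proof (cases "\<exists>d. x < d \<and> d < y \<and> C x d y")
      case False
      then have "(a, x, y) \<in> line_triples C" using less.prems unfolding line_triples_def by blast
      then have "(a, x, y) \<in> line_triples D" using assms(3) by simp
      then show ?thesis by (simp add: line_triples_def)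
    next
      case True
      then obtain d where d: "x < d" "d < y" "C x d y" by blast
      have axd: "C a x d" "C a d y"
        using C.shared_pair[of x y a d] C.perms d less.prems by (metis less_trans nat_neq_iff)+
      \<comment> \<open>The pairs (x, d) and (d, y) span the same line as (x, y), so
        \<open>a\<close> is its first point for them too and the induction hypothesis applies to
        both shorter gaps.\<close>
      have "\<not> C e x d" "\<not> C e d y" if "e < a" for e
        using C.shared_pair[of x d e y] C.shared_pair[of d y e x] C.perms d less.prems that
        by (metis less_trans nat_neq_iff)+
      then have "D a x d" "D a d y"
        using less.hyps[of d x] less.hyps[of y d] axd d less.prems by auto
      then show ?thesis using D.shared_pair[of a d x y] D.perms d by (metis less_trans nat_neq_iff)
    qed
  qed
  have sorted: "D x y z" if xyz: "x < y" "y < z" "C x y z" for x y z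
  proof -
    \<comment> \<open>The first point of the line through the three points.\<close>
    define a where "a = (LEAST d. d = x \<or> C d y z)"
    have a: "a = x \<or> C a y z" unfolding a_def by (rule LeastI[of _ x]) simp
    have "a \<le> x" unfolding a_def by (rule Least_le) simp
    have min: "\<not> C d y z" if "d < a" for d using that not_less_Least unfolding a_def by blast
    show ?thesis
    proof (cases "a = x")
      case True
      then show ?thesis using first[of x y z] xyz min by blast
    next
      case False
      with a \<open>a \<le> x\<close> have ayz: "C a y z" "a < x" by auto
      have "C a x y" using C.shared_pair[of y z a x] C.perms ayz xyz by (metis nat_neq_iff)
      moreover have "\<not> C e x y" if "e < a" for e
        using C.shared_pair[of x y e z] C.perms xyz min[OF that] that ayz by (metis less_trans nat_neq_iff)
      ultimately have "D a x y" using first[of a x y] ayz xyz by blast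
      moreover have "D a y z" using first[of a y z] ayz xyz min by auto
      ultimately show ?thesis using D.shared_pair[of a y x z] D.perms xyz by (metis less_trans nat_neq_iff)
    qed
  qed
  consider "a < b" "b < c" | "a < c" "c < b" | "b < a" "a < c" | "b < c" "c < a" | "c < a" "a < b" | "c < b" "b < a"
    using C.distinct[OF assms(4)] by linarith
  then show ?thesis
    using sorted C.perms[OF assms(4)] D.perms assms(4) by cases blast+
qed

text \<open>Such a set is exactly the set of triangles of its projections: the last clause of
  \<open>unique_triangles\<close> turns three edges that fit together into a member.\<close>

lemma unique_triangles_determined:
  assumes "unique_triangles T" "unique_triangles T'"
    and "(\<lambda>(a, b, c). (a, b)) ` T = (\<lambda>(a, b, c). (a, b)) ` T'"
    and "(\<lambda>(a, b, c). (a, c)) ` T = (\<lambda>(a, b, c). (a, c)) ` T'"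
    and "(\<lambda>(a, b, c). (b, c)) ` T = (\<lambda>(a, b, c). (b, c)) ` T'"
  shows "T = T'"
proof -
  have *: "(a, b, c) \<in> S \<longleftrightarrow> (a, b) \<in> (\<lambda>(a, b, c). (a, b)) ` S
      \<and> (a, c) \<in> (\<lambda>(a, b, c). (a, c)) ` S \<and> (b, c) \<in> (\<lambda>(a, b, c). (b, c)) ` S" (is "?l \<longleftrightarrow> ?r")
    if "unique_triangles S" for a b c and S :: "('a \<times> 'a \<times> 'a) set"
  proof
    assume ?l then show ?r by force
  next
    assume ?r
    then obtain a' b' c' where "(a, b, c') \<in> S" "(a, b', c) \<in> S" "(a', b, c) \<in> S" by auto
    then show ?l using that unfolding unique_triangles_def by blast
  qed
  show ?thesis
    using *[OF assms(1)] *[OF assms(2)] unfolding assms(3-5) by auto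
qed

text \<open>An entropy bound, obtained by giving each subset \<open>B\<close> the weight \<open>x ^ card B\<close>.\<close>

lemma card_small_subsets_le:
  fixes \<epsilon> :: real
  assumes "0 < \<epsilon>"
  shows "\<exists>\<delta>>0. \<forall>A :: 'a set. finite A \<longrightarrow>
    real (card {B. B \<subseteq> A \<and> real (card B) \<le> \<delta> * real (card A)}) \<le> exp (\<epsilon> * real (card A))"
proof -
  \<comment> \<open>With this weight the sum over all subsets is (1 + x)^|A|, at most
    exp(\<epsilon>|A|/2), and \<delta> is chosen so that a subset of size \<delta>|A| would have
    weight exp(-\<epsilon>|A|/2). The cap 1/2 keeps ln(1/x) positive.\<close>
  define x where "x = min (\<epsilon> / 2) (1 / 2)"
  have x: "0 < x" "x < 1" "x \<le> \<epsilon> / 2" using assms unfolding x_def by auto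
  define \<delta> where "\<delta> = \<epsilon> / 2 / ln (1 / x)"
  have lnx: "0 < ln (1 / x)" using x by simp
  have "0 < \<delta>" unfolding \<delta>_def using lnx assms by simp
  moreover have "real (card {B. B \<subseteq> A \<and> real (card B) \<le> \<delta> * real (card A)}) \<le> exp (\<epsilon> * real (card A))"
    if A: "finite A" for A :: "'a set"
  proof -
    let ?S = "{B. B \<subseteq> A \<and> real (card B) \<le> \<delta> * real (card A)}"
    have "real (card ?S) * exp (- (\<epsilon> / 2 * real (card A))) = (\<Sum>B\<in>?S. exp (- (\<epsilon> / 2 * real (card A))))"
      by simp
    also have "\<dots> \<le> (\<Sum>B\<in>?S. x ^ card B)"
    proof (rule sum_mono)
      fix B assume "B \<in> ?S"
      then have "real (card B) * ln (1 / x) \<le> \<delta> * real (card A) * ln (1 / x)"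
        using lnx by (intro mult_right_mono) auto
      also have "\<dots> = \<epsilon> / 2 * real (card A)" unfolding \<delta>_def using lnx by simp
      finally have "exp (- (\<epsilon> / 2 * real (card A))) \<le> exp (real (card B) * ln x)"
        using x by (simp add: ln_div)
      also have "\<dots> = x ^ card B" using x by (simp add: exp_of_nat_mult)
      finally show "exp (- (\<epsilon> / 2 * real (card A))) \<le> x ^ card B" .
    qed
    also have "\<dots> \<le> (\<Sum>B\<in>Pow A. x ^ card B)" using A x by (intro sum_mono2) auto
    also have "\<dots> = (x + 1) ^ card A"
      using prod_add[OF A, of "\<lambda>_. x" "\<lambda>_. 1"] by simp
    also have "\<dots> \<le> exp x ^ card A"
      using exp_ge_add_one_self[of x] x by (intro power_mono) (auto simp: add.commute)
    also have "\<dots> = exp (x * real (card A))" by (simp add: exp_of_nat2_mult)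
    also have "\<dots> \<le> exp (\<epsilon> / 2 * real (card A))"
      unfolding exp_le_cancel_iff using x by (intro mult_right_mono) auto
    finally have "real (card ?S) \<le> exp (\<epsilon> / 2 * real (card A)) * exp (\<epsilon> / 2 * real (card A))"
      by (simp add: exp_minus field_simps)
    then show ?thesis by (simp add: exp_add[symmetric])
  qed
  ultimately show ?thesis by blast
qed

section \<open>Rank-3 matroids\<close>

lemma mrank_eq_card_iff:
  assumes "matroid E I" "X \<subseteq> E"
  shows "mrank I X = card X \<longleftrightarrow> X \<in> I"
proof -
  have fin: "finite X" using assms unfolding matroid_def by (meson finite_subset)
  have ne: "{Y. Y \<subseteq> X \<and> Y \<in> I} \<noteq> {}" using assms unfolding matroid_def by blast
  have finS: "finite {Y. Y \<subseteq> X \<and> Y \<in> I}" using fin by simp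
  show ?thesis
  proof
    assume "mrank I X = card X"
    then have "card X \<in> card ` {Y. Y \<subseteq> X \<and> Y \<in> I}"
      using Max_in[of "card ` {Y. Y \<subseteq> X \<and> Y \<in> I}"] finS ne unfolding mrank_def by auto
    then obtain Y where "Y \<subseteq> X" "Y \<in> I" "card Y = card X" by auto
    then show "X \<in> I" using card_subset_eq[OF fin] by auto
  next
    assume "X \<in> I"
    then show "mrank I X = card X"
      unfolding mrank_def using finS fin by (intro Max_eqI) (auto intro: card_mono)
  qed
qed

text \<open>Contract nothing and delete the complement of \<open>S\<close>; the rank condition then
  reduces to independence.\<close>

lemma is_minor_restriction:
  assumes "matroid E I" "S \<subseteq> E"
  shows "is_minor (S, {X. X \<subseteq> S \<and> X \<in> I}) (E, I)"
  unfolding is_minor_def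
proof (rule exI[of _ "{}"], rule exI[of _ "E - S"], intro conjI)
  have "{} \<in> I" using assms unfolding matroid_def by blast
  then have "mrank I {} = 0" using mrank_eq_card_iff[OF assms(1), of "{}"] by simp
  then show "snd (S, {X. X \<subseteq> S \<and> X \<in> I}) = {X. X \<subseteq> fst (S, {X. X \<subseteq> S \<and> X \<in> I})
      \<and> mrank (snd (E, I)) (X \<union> {}) = card X + mrank (snd (E, I)) {}}"
    using mrank_eq_card_iff[OF assms(1)] assms(2) by auto
qed (use assms in auto)

text \<open>The embeddings constructed below run from {0..5} into the ground set, whereas
  \<open>matroid_iso\<close> asks for a map starting at the minor.\<close>

lemma matroid_iso_inverse:
  assumes g: "bij_betw g (fst N) (fst M)"
    and eq: "\<And>Z. Z \<subseteq> fst N \<Longrightarrow> Z \<in> snd N \<longleftrightarrow> g ` Z \<in> snd M"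
  shows "matroid_iso M N"
  unfolding matroid_iso_def
proof (intro exI conjI allI impI)
  let ?f = "the_inv_into (fst N) g"
  show f: "bij_betw ?f (fst M) (fst N)" using g by (rule bij_betw_the_inv_into)
  fix X assume X: "X \<subseteq> fst M"
  have "g ` ?f ` X = X"
    unfolding image_image using X f_the_inv_into_f_bij_betw[OF g] by (force simp: image_iff)
  moreover have "?f ` X \<subseteq> fst N" using X f by (auto simp: bij_betw_def)
  ultimately show "X \<in> snd M \<longleftrightarrow> ?f ` X \<in> snd N" using eq[of "?f ` X"] by simp
qed

section \<open>Loops, parallel classes and collinear representatives\<close>

locale rank3_matroid =
  fixes n :: nat and I :: "nat set set"
  assumes matroid: "matroid {1..n} I"
    and card_le_3: "X \<in> I \<Longrightarrow> card X \<le> 3"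
begin

lemma subset_ground: "X \<in> I \<Longrightarrow> X \<subseteq> {1..n}"
  using matroid unfolding matroid_def by blast

lemma finite_indep: "X \<in> I \<Longrightarrow> finite X"
  by (rule finite_subset[OF subset_ground]) auto

lemma empty_indep: "{} \<in> I"
  using matroid unfolding matroid_def by blast

lemma indep_subset: "Y \<in> I \<Longrightarrow> X \<subseteq> Y \<Longrightarrow> X \<in> I"
  using matroid unfolding matroid_def by blast

lemma augment: "X \<in> I \<Longrightarrow> Y \<in> I \<Longrightarrow> card X < card Y \<Longrightarrow> \<exists>y\<in>Y - X. insert y X \<in> I"
  using matroid unfolding matroid_def by blast

text \<open>The disjunct \<open>x = y\<close> gives reflexivity on nonloops, where {x, x} = {x} is
  independent.\<close>

definition parallel :: "nat \<Rightarrow> nat \<Rightarrow> bool" where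
  "parallel x y \<longleftrightarrow> {x} \<in> I \<and> {y} \<in> I \<and> (x = y \<or> {x, y} \<notin> I)"

lemma parallel_sym: "parallel x y \<Longrightarrow> parallel y x"
  unfolding parallel_def by (auto simp: insert_commute)

text \<open>If {x, z} were independent, augmenting {y} from it would separate y from x or from
  z.\<close>

lemma parallel_trans: "parallel x y \<Longrightarrow> parallel y z \<Longrightarrow> parallel x z"
proof (rule ccontr)
  assume *: "parallel x y" "parallel y z" "\<not> parallel x z"
  then have "{x, z} \<in> I" "x \<noteq> z" "{y} \<in> I" unfolding parallel_def by auto
  then obtain u where "u \<in> {x, z} - {y}" "{u, y} \<in> I" using augment[of "{y}" "{x, z}"] by auto
  then show False using * unfolding parallel_def by (auto simp: insert_commute)
qed

text \<open>Loops are sent to \<open>0\<close>, which lies outside the ground set.\<close>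

definition rep :: "nat \<Rightarrow> nat" where
  "rep x = (if {x} \<in> I then Min {y. parallel x y} else 0)"

lemma parallel_rep: "{x} \<in> I \<Longrightarrow> parallel x (rep x)"
proof -
  assume x: "{x} \<in> I"
  have "{y. parallel x y} \<subseteq> {1..n}" using subset_ground unfolding parallel_def by blast
  then have "finite {y. parallel x y}" by (rule finite_subset) simp
  moreover have "x \<in> {y. parallel x y}" using x unfolding parallel_def by simp
  ultimately have "Min {y. parallel x y} \<in> {y. parallel x y}" using Min_in by blast
  then show ?thesis using x unfolding rep_def by simp
qed

lemma rep_eq_0_iff: "rep x = 0 \<longleftrightarrow> {x} \<notin> I"
proof -
  have "rep x \<noteq> 0" if "{x} \<in> I"
  proof -
    have "{rep x} \<in> I" using parallel_rep[OF that] unfolding parallel_def by blast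
    then show ?thesis using subset_ground by fastforce
  qed
  then show ?thesis unfolding rep_def by auto
qed

lemma rep_le: "rep x \<le> n"
proof (cases "{x} \<in> I")
  case True
  then have "{rep x} \<in> I" using parallel_rep unfolding parallel_def by blast
  then show ?thesis using subset_ground by fastforce
qed (simp add: rep_def)

lemma rep_eq_iff:
  assumes "{x} \<in> I" "{y} \<in> I"
  shows "rep x = rep y \<longleftrightarrow> parallel x y"
proof
  assume "rep x = rep y"
  then show "parallel x y"
    using parallel_rep assms parallel_sym parallel_trans by metis
next
  assume xy: "parallel x y"
  have "{z. parallel x z} = {z. parallel y z}"
    using xy parallel_sym parallel_trans by blast
  then show "rep x = rep y" using assms unfolding rep_def by simp
qed

lemma pair_indep_iff: "x \<noteq> y \<Longrightarrow> {x, y} \<in> I \<longleftrightarrow> rep x \<noteq> 0 \<and> rep y \<noteq> 0 \<and> rep x \<noteq> rep y"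
  using rep_eq_iff[of x y] indep_subset[of "{x, y}" "{x}"] indep_subset[of "{x, y}" "{y}"]
  unfolding rep_eq_0_iff parallel_def by auto

text \<open>Since \<open>rep 0 = 0\<close>, the value reserved for loops has to be excluded
  explicitly.\<close>

definition reps :: "nat set" where
  "reps = {x. rep x = x \<and> x \<noteq> 0}"

lemma reps_subset: "reps \<subseteq> {1..n}"
proof
  fix x assume "x \<in> reps"
  then show "x \<in> {1..n}" using rep_le[of x] unfolding reps_def by auto
qed

lemma rep_in_reps: "{x} \<in> I \<Longrightarrow> rep x \<in> reps"
  using parallel_rep[of x] rep_eq_iff[of x "rep x"] rep_eq_0_iff[of x]
  unfolding reps_def parallel_def by auto

lemma reps_pair_indep: "x \<in> reps \<Longrightarrow> y \<in> reps \<Longrightarrow> {x, y} \<in> I"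
  using pair_indep_iff[of x y] rep_eq_0_iff[of x] unfolding reps_def by (cases "x = y") auto

text \<open>Augment {x'} from {x, y} and the result from {x, y, z}. Neither step can add x, as {x,
  x'} is dependent, so y and then z are added.\<close>

lemma replace_parallel:
  assumes "parallel x x'" "{x, y, z} \<in> I" "x \<noteq> y" "x \<noteq> z" "y \<noteq> z"
  shows "{x', y, z} \<in> I \<and> x' \<noteq> y \<and> x' \<noteq> z"
proof (cases "x = x'")
  case False
  have par: "{x, x'} \<notin> I" "{x'} \<in> I" using assms(1) False unfolding parallel_def by auto
  have x': "x' \<noteq> y" "x' \<noteq> z"
    using par indep_subset[OF assms(2), of "{x, x'}"] by auto
  have "{x, y} \<in> I" using indep_subset[OF assms(2)] by auto
  then obtain u where "u \<in> {x, y} - {x'}" "{u, x'} \<in> I"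
    using augment[of "{x'}" "{x, y}"] par assms by auto
  then have "{x', y} \<in> I" using par by (auto simp: insert_commute)
  then obtain u where u: "u \<in> {x, y, z} - {x', y}" "insert u {x', y} \<in> I"
    using augment[of "{x', y}" "{x, y, z}"] assms x' by auto
  then have "u \<noteq> x" using par indep_subset[OF u(2), of "{x, x'}"] by auto
  with u have "u = z" by auto
  with u x' show ?thesis by (simp add: insert_commute)
qed (use assms in simp)

text \<open>The elements are exchanged for their representatives one at a time; with the converse
  below, independence of a triple is decided by its representatives.\<close>

lemma triple_indep_rep:
  assumes "{x, y, z} \<in> I" "x \<noteq> y" "x \<noteq> z" "y \<noteq> z"
  shows "{rep x, rep y, rep z} \<in> I \<and> rep x \<noteq> rep y \<and> rep x \<noteq> rep z \<and> rep y \<noteq> rep z"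
proof -
  have sing: "{x} \<in> I" "{y} \<in> I" "{z} \<in> I" using indep_subset[OF assms(1)] by auto
  have 1: "{rep x, y, z} \<in> I" "rep x \<noteq> y" "rep x \<noteq> z"
    using replace_parallel[OF parallel_rep[OF sing(1)] assms(1)] assms by auto
  have 2: "{rep x, rep y, z} \<in> I" "rep x \<noteq> rep y" "rep y \<noteq> z"
    using replace_parallel[OF parallel_rep[OF sing(2)], of "rep x" z] 1 assms by (auto simp: insert_commute)
  have "{z, rep x, rep y} \<in> I" using 2(1) by (simp add: insert_commute)
  then have "{rep z, rep x, rep y} \<in> I" "rep z \<noteq> rep x" "rep z \<noteq> rep y"
    using replace_parallel[OF parallel_rep[OF sing(3)], of "rep x" "rep y"] 1 2 by auto
  then show ?thesis using 2 by (auto simp: insert_commute)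
qed

lemma triple_indep_of_rep:
  assumes "{rep x, rep y, rep z} \<in> I" "rep x \<noteq> rep y" "rep x \<noteq> rep z" "rep y \<noteq> rep z"
    "rep x \<noteq> 0" "rep y \<noteq> 0" "rep z \<noteq> 0"
  shows "{x, y, z} \<in> I"
proof -
  have sing: "{x} \<in> I" "{y} \<in> I" "{z} \<in> I" using assms rep_eq_0_iff by auto
  have 1: "{x, rep y, rep z} \<in> I" "x \<noteq> rep y" "x \<noteq> rep z"
    using replace_parallel[OF parallel_sym[OF parallel_rep[OF sing(1)]] assms(1)] assms by auto
  have 2: "{x, y, rep z} \<in> I" "x \<noteq> y" "y \<noteq> rep z"
    using replace_parallel[OF parallel_sym[OF parallel_rep[OF sing(2)]], of x "rep z"] 1 assms
    by (auto simp: insert_commute)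
  have "{rep z, x, y} \<in> I" using 2(1) by (simp add: insert_commute)
  then have "{z, x, y} \<in> I"
    using replace_parallel[OF parallel_sym[OF parallel_rep[OF sing(3)]], of x y] 1 2 by auto
  then show ?thesis by (simp add: insert_commute)
qed

definition coll :: "nat \<Rightarrow> nat \<Rightarrow> nat \<Rightarrow> bool" where
  "coll a b c \<longleftrightarrow> {a, b, c} \<subseteq> reps \<and> a \<noteq> b \<and> a \<noteq> c \<and> b \<noteq> c \<and> {a, b, c} \<notin> I"

sublocale collinearity coll
proof
  show "coll a b c \<Longrightarrow> coll b a c" "coll a b c \<Longrightarrow> coll a c b" "\<not> coll a a c" for a b c
    unfolding coll_def by (auto simp: insert_commute)
  fix a b c d assume abc: "coll a b c" and abd: "coll a b d" and "c \<noteq> d"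
  show "coll b c d"
  proof (rule ccontr)
    assume "\<not> coll b c d"
    then have "{b, c, d} \<in> I" using abc abd \<open>c \<noteq> d\<close> unfolding coll_def by auto
    moreover have "{a, b} \<in> I" using abc reps_pair_indep unfolding coll_def by auto
    \<comment> \<open>Augmenting {a, b} from {b, c, d} can only add c or d, but both resulting
      triples are dependent.\<close>
    ultimately obtain u where "u \<in> {b, c, d} - {a, b}" "insert u {a, b} \<in> I"
      using augment[of "{a, b}" "{b, c, d}"] abc abd \<open>c \<noteq> d\<close> unfolding coll_def by auto
    then show False using abc abd unfolding coll_def by (auto simp: insert_commute)
  qed
qed

end

text \<open>Independent sets of size at most two are read off from \<open>rep\<close>, those of size
  three from \<open>rep\<close> and \<open>coll\<close>. As an inclusion it serves both directions
  of an equality.\<close>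

lemma rank3_matroid_subset:
  assumes "rank3_matroid n I" "rank3_matroid n J"
    and rep: "\<And>x. x \<in> {1..n} \<Longrightarrow> rank3_matroid.rep I x = rank3_matroid.rep J x"
    and coll: "\<And>a b c. rank3_matroid.coll J a b c \<Longrightarrow> rank3_matroid.coll I a b c"
  shows "I \<subseteq> J"
proof
  interpret I: rank3_matroid n I by fact
  interpret J: rank3_matroid n J by fact
  fix X assume X: "X \<in> I"
  have sub: "X \<subseteq> {1..n}" using I.subset_ground[OF X] .
  have fin: "finite X" using I.finite_indep[OF X] .
  consider "card X = 0" | "card X = 1" | "card X = 2" | "card X = 3"
    using I.card_le_3[OF X] by linarith
  then show "X \<in> J"
  proof cases
    case 1
    then show ?thesis using fin J.empty_indep by simp
  next
    case 2
    then obtain x where x: "X = {x}" using card_1_singletonE by blast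
    then show ?thesis using X sub rep[of x] I.rep_eq_0_iff[of x] J.rep_eq_0_iff[of x] by simp
  next
    case 3
    then obtain x y where xy: "X = {x, y}" "x \<noteq> y" using card_2_iff by metis
    then show ?thesis using X sub rep[of x] rep[of y] I.pair_indep_iff[of x y] J.pair_indep_iff[of x y] by simp
  next
    case 4
    then obtain x y z where xyz: "X = {x, y, z}" "x \<noteq> y" "x \<noteq> z" "y \<noteq> z" using card_3_iff by metis
    have eq: "I.rep x = J.rep x" "I.rep y = J.rep y" "I.rep z = J.rep z" using rep xyz(1) sub by auto
    have sing: "{x} \<in> I" "{y} \<in> I" "{z} \<in> I" using I.indep_subset[OF X] xyz(1) by auto
    then have nz: "I.rep x \<noteq> 0" "I.rep y \<noteq> 0" "I.rep z \<noteq> 0" using I.rep_eq_0_iff by auto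
    then have singJ: "{x} \<in> J" "{y} \<in> J" "{z} \<in> J" using J.rep_eq_0_iff eq by auto
    note I3 = I.triple_indep_rep[OF X[unfolded xyz(1)] xyz(2-4)]
    then have "\<not> I.coll (I.rep x) (I.rep y) (I.rep z)" unfolding I.coll_def by blast
    then have "\<not> J.coll (I.rep x) (I.rep y) (I.rep z)" using coll by blast
    then have "{J.rep x, J.rep y, J.rep z} \<in> J"
      using J.rep_in_reps[OF singJ(1)] J.rep_in_reps[OF singJ(2)] J.rep_in_reps[OF singJ(3)] I3
      unfolding J.coll_def eq by blast
    then show ?thesis using J.triple_indep_of_rep I3 nz unfolding eq xyz(1) by blast
  qed
qed

section \<open>Whirl and M(K4) as restrictions to six points\<close>

lemma sorted_triple_eq_iff:
  fixes i j k p q r :: nat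
  assumes "i < j" "j < k" "p < q" "q < r"
  shows "{i, j, k} = {p, q, r} \<longleftrightarrow> i = p \<and> j = q \<and> k = r"
  using strict_sorted_equal[of "[i, j, k]" "[p, q, r]"] assms by auto

lemma card_3_sorted:
  fixes Z :: "nat set"
  assumes "card Z = 3"
  obtains i j k where "i < j" "j < k" "Z = {i, j, k}"
proof -
  have "finite Z" using assms by (metis card.infinite zero_neq_numeral)
  moreover have "length (sorted_list_of_set Z) = 3" using assms by simp
  then obtain i j k where "sorted_list_of_set Z = [i, j, k]"
    unfolding numeral_3_eq_3 length_Suc_conv by auto
  moreover have "sorted_wrt (<) (sorted_list_of_set Z)" by simp
  ultimately show ?thesis using that[of i j k] set_sorted_list_of_set[of Z] by simp
qed

context rank3_matroid
begin

text \<open>Representatives are pairwise independent and sets of more than three elements are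
  dependent, so only the 3-sets need comparing. The parameter \<open>L\<close> covers the whirl and
  M(K4) at once.\<close>

lemma minor_iso_if_lines:
  fixes g :: "nat \<Rightarrow> nat"
  assumes inj: "inj_on g {0..5}" and reps: "g ` {0..5} \<subseteq> reps"
    and lines: "\<And>i j k. i < j \<Longrightarrow> j < k \<Longrightarrow> k \<le> 5 \<Longrightarrow> {g i, g j, g k} \<in> I \<longleftrightarrow> {i, j, k} \<notin> L"
    and L: "\<And>l. l \<in> L \<Longrightarrow> card l = 3"
  shows "\<exists>N. is_minor N ({1..n}, I) \<and> matroid_iso N ({0..5}, {X. X \<subseteq> {0..5} \<and> card X \<le> 3 \<and> X \<notin> L})"
proof (intro exI conjI)
  let ?S = "g ` {0..5}"
  have g_reps: "g i \<in> reps" if "i \<le> 5" for i using reps that by auto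
  have "?S \<subseteq> {1..n}" using reps reps_subset by blast
  then show "is_minor (?S, {X. X \<subseteq> ?S \<and> X \<in> I}) ({1..n}, I)"
    by (rule is_minor_restriction[OF matroid])
  show "matroid_iso (?S, {X. X \<subseteq> ?S \<and> X \<in> I}) ({0..5}, {X. X \<subseteq> {0..5} \<and> card X \<le> 3 \<and> X \<notin> L})"
  proof (rule matroid_iso_inverse[of g])
    show "bij_betw g (fst ({0..5}, {X. X \<subseteq> {0..5} \<and> card X \<le> 3 \<and> X \<notin> L})) (fst (?S, {X. X \<subseteq> ?S \<and> X \<in> I}))"
      using inj by (simp add: bij_betw_def)
    fix Z :: "nat set" assume "Z \<subseteq> fst ({0..5}, {X. X \<subseteq> {0..5::nat} \<and> card X \<le> 3 \<and> X \<notin> L})"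
    then have Z: "Z \<subseteq> {0..5}" by simp
    have finZ: "finite Z" using finite_subset[OF Z] by simp
    have card: "card (g ` Z) = card Z" using inj_on_subset[OF inj Z] by (rule card_image)
    have "card Z \<le> 3 \<and> Z \<notin> L \<longleftrightarrow> g ` Z \<in> I"
    proof -
      consider "card Z = 0" | "card Z = 1" | "card Z = 2" | "card Z = 3" | "card Z > 3" by linarith
      then show ?thesis
      proof cases
        case 1
        then show ?thesis using finZ empty_indep L[of Z] by auto
      next
        case 2
        then obtain i where "Z = {i}" using card_1_singletonE by blast
        then show ?thesis using Z 2 reps_pair_indep[OF g_reps g_reps, of i i] L[of Z] by auto
      next
        case 3
        then obtain i j where "Z = {i, j}" using card_2_iff by metis
        then show ?thesis using Z 3 reps_pair_indep[OF g_reps g_reps, of i j] L[of Z] by auto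
      next
        case 4
        then obtain i j k where "i < j" "j < k" "Z = {i, j, k}" by (rule card_3_sorted)
        then show ?thesis using lines[of i j k] Z 4 by simp
      next
        case 5
        then show ?thesis using card card_le_3[of "g ` Z"] by auto
      qed
    qed
    then show "Z \<in> snd ({0..5}, {X. X \<subseteq> {0..5} \<and> card X \<le> 3 \<and> X \<notin> L})
        \<longleftrightarrow> g ` Z \<in> snd (?S, {X. X \<subseteq> ?S \<and> X \<in> I})"
      using Z by auto
  qed
qed

definition noncoll :: "nat \<Rightarrow> nat \<Rightarrow> nat \<Rightarrow> bool" where
  "noncoll a b c \<longleftrightarrow> {a, b, c} \<subseteq> reps \<and> a \<noteq> b \<and> a \<noteq> c \<and> b \<noteq> c \<and> {a, b, c} \<in> I"

lemma noncoll_perms: "noncoll a b c \<Longrightarrow>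
    noncoll a c b \<and> noncoll b a c \<and> noncoll b c a \<and> noncoll c a b \<and> noncoll c b a"
  unfolding noncoll_def by (auto simp: insert_commute)

text \<open>A further point s of the line pq spans that same line with p or with q, so it cannot be
  collinear with r and one of them.\<close>

lemma noncoll_replace:
  assumes "noncoll p q r" "coll p q s"
  shows "noncoll p s r \<and> noncoll q s r"
proof -
  have nc: "\<not> coll p q r" using assms(1) unfolding noncoll_def coll_def by blast
  then have "s \<noteq> r" using assms(2) by blast
  moreover have "\<not> coll p s r" "\<not> coll q s r"
    using nc shared_pair[of p s q r] shared_pair[of q s p r] perms assms unfolding noncoll_def by blast+
  ultimately show ?thesis using assms unfolding noncoll_def coll_def by blast
qed

lemma coll_if_pairwise_long:
  assumes no_whirl: "\<not> (\<exists>N. is_minor N ({1..n}, I) \<and> matroid_iso N whirl3)"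
    and no_MK4: "\<not> (\<exists>N. is_minor N ({1..n}, I) \<and> matroid_iso N MK4)"
    and lines: "coll a b x" "coll b c y" "coll a c z"
  shows "coll a b c"
proof (rule ccontr)
  assume "\<not> coll a b c"
  then have abc: "noncoll a b c" using lines unfolding noncoll_def coll_def by auto
  have 1: "noncoll a x c" "noncoll b x c" "noncoll b y a" "noncoll c y a" "noncoll a z b" "noncoll c z b"
    using noncoll_replace[OF abc lines(1)] noncoll_replace[of b c a y] noncoll_replace[of a c b z]
      lines abc noncoll_perms by blast+
  have 2: "noncoll a z x" "noncoll c z x" using noncoll_replace[of a c x z] 1 lines noncoll_perms by blast+
  have 3: "noncoll b y x" "noncoll c y x" using noncoll_replace[of b c x y] 1 lines noncoll_perms by blast+
  have 4: "noncoll a z y" "noncoll c z y" using noncoll_replace[of a c y z] 1 lines noncoll_perms by blast+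
  have 5: "noncoll a x y" using noncoll_replace[of a b y x] 1 lines noncoll_perms by blast
  have 6: "noncoll b y z" using noncoll_replace[of b c z y] 1 lines noncoll_perms by blast
  have 7: "noncoll b x z" using noncoll_replace[of a b z x] 1 lines noncoll_perms by blast
  note nc = abc 1 2 3 4 5 6 7
  \<comment> \<open>Of the 20 triples among the six points, these 16 are independent and the three
    given lines are dependent. Only {x, y, z} remains open, and it decides between the two
    minors.\<close>
  have indep: "{a, x, y} \<in> I" "{a, x, c} \<in> I" "{a, x, z} \<in> I" "{a, b, y} \<in> I" "{a, b, c} \<in> I"
    "{a, b, z} \<in> I" "{a, y, c} \<in> I" "{a, y, z} \<in> I" "{x, b, y} \<in> I" "{x, b, c} \<in> I"
    "{x, b, z} \<in> I" "{x, y, c} \<in> I" "{x, c, z} \<in> I" "{b, y, z} \<in> I" "{b, c, z} \<in> I" "{y, c, z} \<in> I"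
    using nc unfolding noncoll_def by (simp_all add: insert_commute)
  have dep: "{a, x, b} \<notin> I" "{b, y, c} \<notin> I" "{a, c, z} \<notin> I"
    using lines unfolding coll_def by (simp_all add: insert_commute)
  \<comment> \<open>The cyclic order around the triangle abc, with each chosen point between its two
    corners: positions 012, 234, 450 are the lines, and 135 is {x, y, z}.\<close>
  define ps where "ps = [a, x, b, y, c, z]"
  have distinct: "distinct ps" using nc lines unfolding ps_def noncoll_def coll_def by auto
  have inj: "inj_on ((!) ps) {0..5}" by (rule inj_on_nth[OF distinct]) (simp add: ps_def)
  have "(!) ps ` {0..5} \<subseteq> set ps"
  proof
    fix u assume "u \<in> (!) ps ` {0..5}"
    then obtain i where "u = ps ! i" "i < length ps" unfolding ps_def by auto
    then show "u \<in> set ps" by simp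
  qed
  also have "set ps \<subseteq> reps" using lines unfolding ps_def coll_def by auto
  finally have reps: "(!) ps ` {0..5} \<subseteq> reps" .
  let ?L = "if {x, y, z} \<in> I then {} else {{1,3,5::nat}}"
  have triples: "{ps ! i, ps ! j, ps ! k} \<in> I \<longleftrightarrow> {i, j, k} \<notin> {{0,1,2},{2,3,4},{4,5,0}} \<union> ?L"
    if "i < j" "j < k" "k \<le> 5" for i j k :: nat
  proof -
    have "{i, j, k} \<notin> {{0,1,2},{2,3,4},{4,5,0}} \<union> ?L \<longleftrightarrow> (i, j, k) \<notin> {(0,1,2),(2,3,4),(0,4,5)}
        \<and> ((i, j, k) = (1,3,5) \<longrightarrow> {x, y, z} \<in> I)"
      using sorted_triple_eq_iff[OF that(1,2), of 0 1 2] sorted_triple_eq_iff[OF that(1,2), of 2 3 4]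
        sorted_triple_eq_iff[OF that(1,2), of 0 4 5] sorted_triple_eq_iff[OF that(1,2), of 1 3 5]
      by (auto simp: insert_commute[of 5 0] insert_commute[of 4 0])
    moreover have "i = 0 \<or> i = 1 \<or> i = 2 \<or> i = 3" "j = 1 \<or> j = 2 \<or> j = 3 \<or> j = 4"
      "k = 2 \<or> k = 3 \<or> k = 4 \<or> k = 5" using that by linarith+
    ultimately show ?thesis
      using that(1,2) indep dep by (elim disjE) (simp_all add: ps_def numeral_eq_Suc)
  qed
  show False
  proof (cases "{x, y, z} \<in> I")
    case True
    have "\<exists>N. is_minor N ({1..n}, I) \<and> matroid_iso N whirl3"
      unfolding whirl3_def
    proof (rule minor_iso_if_lines[OF inj reps])
      fix i j k :: nat assume ijk: "i < j" "j < k" "k \<le> 5"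
      show "{ps ! i, ps ! j, ps ! k} \<in> I \<longleftrightarrow> {i, j, k} \<notin> {{0,1,2},{2,3,4},{4,5,0}}"
        using triples[OF ijk] unfolding if_P[OF True] Un_empty_right .
    qed auto
    then show False using no_whirl by blast
  next
    case False
    have "\<exists>N. is_minor N ({1..n}, I) \<and> matroid_iso N MK4"
      unfolding MK4_def
    proof (rule minor_iso_if_lines[OF inj reps])
      fix i j k :: nat assume ijk: "i < j" "j < k" "k \<le> 5"
      show "{ps ! i, ps ! j, ps ! k} \<in> I \<longleftrightarrow> {i, j, k} \<notin> {{0,1,2},{2,3,4},{4,5,0},{1,3,5}}"
        using triples[OF ijk] unfolding if_not_P[OF False] Un_insert_left Un_empty_left .
    qed auto
    then show False using no_MK4 by blast
  qed
qed

end

section \<open>Counting the matroids\<close>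

lemma rank3_matroidI:
  assumes "matroid {1..n} I" "mrank I {1..n} = 3"
  shows "rank3_matroid n I"
proof
  fix X assume X: "X \<in> I"
  have "I \<subseteq> Pow {1..n}" using assms(1) unfolding matroid_def by (elim conjE)
  with X have "card X \<in> card ` {Y. Y \<subseteq> {1..n} \<and> Y \<in> I}" by blast
  moreover have "finite {Y. Y \<subseteq> {1..n} \<and> Y \<in> I}" by simp
  ultimately show "card X \<le> 3"
    using assms(2) Max_ge[of "card ` {Y. Y \<subseteq> {1..n} \<and> Y \<in> I}"] unfolding mrank_def by fastforce
qed fact

text \<open>The quadratic Taylor bound gives n + 1 \<le> exp(\<epsilon> n) once \<epsilon>^2 n \<ge>
  2; then take n-th powers.\<close>

lemma eventually_Suc_power_le:
  fixes \<epsilon> :: real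
  assumes "0 < \<epsilon>"
  shows "\<forall>\<^sub>F n in sequentially. real (Suc n) ^ n \<le> exp (\<epsilon> * (real n)\<^sup>2)"
proof -
  obtain m :: nat where m: "2 / \<epsilon>\<^sup>2 \<le> real m" using real_arch_simple by blast
  have "real (Suc n) ^ n \<le> exp (\<epsilon> * (real n)\<^sup>2)" if "m \<le> n" for n
  proof -
    have "2 \<le> \<epsilon>\<^sup>2 * real m" using m assms by (simp add: field_simps)
    also have "\<dots> \<le> \<epsilon>\<^sup>2 * real n" using that by (intro mult_left_mono) auto
    finally have "2 \<le> \<epsilon>\<^sup>2 * real n" .
    then have "2 * real n \<le> \<epsilon>\<^sup>2 * real n * real n" by (intro mult_right_mono) auto
    then have "real (Suc n) \<le> 1 + \<epsilon> * real n + (\<epsilon> * real n)\<^sup>2 / 2"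
    proof -
      have "(\<epsilon> * real n)\<^sup>2 = \<epsilon>\<^sup>2 * real n * real n" by (simp add: power2_eq_square mult_ac)
      moreover have "0 \<le> \<epsilon> * real n" using assms by simp
      ultimately show ?thesis using \<open>2 * real n \<le> _\<close> by simp
    qed
    also have "\<dots> \<le> exp (\<epsilon> * real n)" using assms by (intro exp_lower_Taylor_quadratic) auto
    finally have "real (Suc n) ^ n \<le> exp (\<epsilon> * real n) ^ n" by (intro power_mono) auto
    then show ?thesis by (simp add: exp_of_nat2_mult[symmetric] power2_eq_square mult.assoc)
  qed
  then show ?thesis unfolding eventually_sequentially by blast
qed

theorem theorem3:
  shows "\<forall>\<epsilon>>0. \<forall>\<^sub>F n in sequentially.
           real (count_rk3 n) \<le> 2 powr (\<epsilon> * (real n)^2)"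
proof (intro allI impI)
  fix \<epsilon> :: real assume "0 < \<epsilon>"
  \<comment> \<open>Four factors exp(\<eta> n^2) will be multiplied, one for \<open>rep\<close> and
    one for each projection; ln 2 converts to base 2.\<close>
  define \<eta> where "\<eta> = \<epsilon> * ln 2 / 4"
  have \<eta>: "0 < \<eta>" unfolding \<eta>_def using \<open>0 < \<epsilon>\<close> by simp
  obtain \<delta> where \<delta>: "0 < \<delta>" "\<And>A :: (nat \<times> nat) set. finite A \<Longrightarrow>
      real (card {B. B \<subseteq> A \<and> real (card B) \<le> \<delta> * real (card A)}) \<le> exp (\<eta> * real (card A))"
    using card_small_subsets_le[OF \<eta>, where 'a = "nat \<times> nat"] by blast
  obtain n0 where n0: "\<And>V T. finite (V :: nat set) \<Longrightarrow> n0 \<le> card V \<Longrightarrow> T \<subseteq> V \<times> V \<times> V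
    \<Longrightarrow> unique_triangles T \<Longrightarrow> real (card T) \<le> \<delta> * (real (card V))\<^sup>2"
    using ruzsa_szemeredi[OF \<delta>(1), where 'a = nat] by blast
  have bound: "real (count_rk3 n) \<le> 2 powr (\<epsilon> * (real n)^2)"
    if n: "n0 \<le> n" "real (Suc n) ^ n \<le> exp (\<eta> * (real n)\<^sup>2)" for n
  proof -
    let ?V = "{1..n}"
    define \<M> where "\<M> = {I. matroid ?V I \<and> mrank I ?V = 3
      \<and> \<not> (\<exists>N. is_minor N (?V, I) \<and> matroid_iso N whirl3)
      \<and> \<not> (\<exists>N. is_minor N (?V, I) \<and> matroid_iso N MK4)}"
    define S where "S = {B. B \<subseteq> ?V \<times> ?V \<and> real (card B) \<le> \<delta> * real (card (?V \<times> ?V))}"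
    \<comment> \<open>The value 0 marks loops, so each element has n + 1 possible images.\<close>
    define F where "F = (\<Pi>\<^sub>E x\<in>?V. {..n})"
    define T where "T I = line_triples (rank3_matroid.coll I)" for I
    \<comment> \<open>The matroid is recovered in stages: the projections give \<open>T I\<close>,
      this gives \<open>coll\<close>, and \<open>coll\<close> with \<open>rep\<close> gives
      \<open>I\<close>. Each projection has at most as many elements as \<open>T I\<close>, hence
      lies in \<open>S\<close>.\<close>
    define code where "code I = (restrict (rank3_matroid.rep I) ?V, (\<lambda>(a, b, c). (a, b)) ` T I,
      (\<lambda>(a, b, c). (a, c)) ` T I, (\<lambda>(a, b, c). (b, c)) ` T I)" for I
    have rk: "rank3_matroid n I" if "I \<in> \<M>" for I
      using that rank3_matroidI unfolding \<M>_def by blast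
    have col: "collinearity (rank3_matroid.coll I)" if "I \<in> \<M>" for I
    proof -
      interpret rank3_matroid n I using rk[OF that] .
      show ?thesis by unfold_locales
    qed
    have ut: "unique_triangles (T I)" if "I \<in> \<M>" for I
    proof -
      interpret rank3_matroid n I using rk[OF that] .
      show ?thesis unfolding T_def
        using that coll_if_pairwise_long unfolding \<M>_def by (intro unique_triangles_line_triples) blast
    qed
    have TV: "T I \<subseteq> ?V \<times> ?V \<times> ?V" if "I \<in> \<M>" for I
    proof -
      interpret rank3_matroid n I using rk[OF that] .
      show ?thesis unfolding T_def line_triples_def coll_def using reps_subset by auto
    qed
    have cardT: "finite (T I)" "real (card (T I)) \<le> \<delta> * real (card (?V \<times> ?V))" if "I \<in> \<M>" for I
    proof -
      show "finite (T I)" using TV[OF that] by (rule finite_subset) simp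
      show "real (card (T I)) \<le> \<delta> * real (card (?V \<times> ?V))"
        using n0[OF _ _ TV[OF that] ut[OF that]] n(1) by (simp add: card_cartesian_product power2_eq_square)
    qed
    have "inj_on code \<M>"
    proof (rule inj_onI)
      fix I J assume I: "I \<in> \<M>" and J: "J \<in> \<M>" and eq: "code I = code J"
      have "T I = T J"
        using eq unfolding code_def by (intro unique_triangles_determined[OF ut[OF I] ut[OF J]]) auto
      then have "rank3_matroid.coll I a b c \<longleftrightarrow> rank3_matroid.coll J a b c" for a b c
        using line_triples_determine[OF col[OF I] col[OF J]] line_triples_determine[OF col[OF J] col[OF I]]
        unfolding T_def by auto
      moreover have "rank3_matroid.rep I x = rank3_matroid.rep J x" if "x \<in> ?V" for x
      proof -
        have "restrict (rank3_matroid.rep I) ?V x = restrict (rank3_matroid.rep J) ?V x"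
          using eq unfolding code_def by simp
        then show ?thesis using that by simp
      qed
      ultimately show "I = J"
        using rank3_matroid_subset[OF rk[OF I] rk[OF J]] rank3_matroid_subset[OF rk[OF J] rk[OF I]]
        by auto
    qed
    moreover have "code ` \<M> \<subseteq> F \<times> S \<times> S \<times> S"
    proof
      fix p assume "p \<in> code ` \<M>"
      then obtain I where I: "I \<in> \<M>" "p = code I" by blast
      interpret rank3_matroid n I using rk[OF I(1)] .
      have "h ` T I \<in> S" if "h ` T I \<subseteq> ?V \<times> ?V" for h
        using that card_image_le[OF cardT(1)[OF I(1)], of h] cardT(2)[OF I(1)]
        unfolding S_def by (auto intro: order.trans[of _ "real (card (T I))"])
      moreover have "restrict rep ?V \<in> F" unfolding F_def using rep_le by auto
      moreover have "(\<lambda>(a, b, c). (a, b)) ` T I \<subseteq> ?V \<times> ?V" "(\<lambda>(a, b, c). (a, c)) ` T I \<subseteq> ?V \<times> ?V"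
        "(\<lambda>(a, b, c). (b, c)) ` T I \<subseteq> ?V \<times> ?V" using TV[OF I(1)] by auto
      ultimately show "p \<in> F \<times> S \<times> S \<times> S"
        unfolding I(2) code_def by (intro SigmaI) blast+
    qed
    moreover have finite: "finite F" "finite S" unfolding F_def S_def by (auto intro: finite_PiE)
    ultimately have "card \<M> \<le> card (F \<times> S \<times> S \<times> S)"
      by (intro card_inj_on_le[of code]) auto
    moreover have "card F = Suc n ^ n" unfolding F_def by (simp add: card_PiE)
    ultimately have "card \<M> \<le> Suc n ^ n * (card S * (card S * card S))"
      by (simp add: card_cartesian_product)
    then have "real (card \<M>) \<le> real (Suc n ^ n * (card S * (card S * card S)))" by (rule of_nat_mono)
    also have "\<dots> = real (Suc n) ^ n * (real (card S) * (real (card S) * real (card S)))"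
      by (simp only: of_nat_mult of_nat_power)
    also have "\<dots> \<le> exp (\<eta> * (real n)\<^sup>2) * (exp (\<eta> * (real n)\<^sup>2) * (exp (\<eta> * (real n)\<^sup>2) * exp (\<eta> * (real n)\<^sup>2)))"
    proof -
      have "real (card S) \<le> exp (\<eta> * (real n)\<^sup>2)"
        using \<delta>(2)[of "?V \<times> ?V"] unfolding S_def by (simp add: card_cartesian_product power2_eq_square)
      then show ?thesis using n(2) by (intro mult_mono) auto
    qed
    also have "\<dots> = exp (\<epsilon> * (real n)\<^sup>2 * ln 2)"
      unfolding \<eta>_def by (simp add: exp_add[symmetric] field_simps)
    also have "\<dots> = 2 powr (\<epsilon> * (real n)^2)" by (simp add: powr_def)
    finally show ?thesis unfolding count_rk3_def \<M>_def .
  qed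
  show "\<forall>\<^sub>F n in sequentially. real (count_rk3 n) \<le> 2 powr (\<epsilon> * (real n)^2)"
    using eventually_ge_at_top[of n0] eventually_Suc_power_le[OF \<eta>]
    by eventually_elim (rule bound)
qed

end
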